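(* Let $d \geq 2$, let $\Lambda = Mat_d^0(\mathbb{Z})$, and let $B \subset \Lambda$ be a set of positive upper Banach density. Suppose there exists an ergodic Furstenberg system $(X,\eta,\sigma,\tilde B)$ corresponding to $B$ whose spectral measure has no atoms at non-trivial characters of $\Lambda$ of finite order. Then for every $C \in \Lambda$ there exist $A \in B - B$ and $g \in SL_d(\mathbb{Z})$ with $C = g^{-1}Ag$.
   Context: $Mat_d^0(\mathbb{Z})$ is the additive group of $d\times d$ integer matrices with trace zero. A sequence $(F_n)$ of finite subsets of a countable abelian group $G$ is Følner if $|F_n\cap(F_n+g)|/|F_n|\to 1$ for all $g\in G$. The upper Banach density of $B\subset G$ is $d^*(B)=\sup_{(F_n)\text{ Følner}}\limsup_n |B\cap F_n|/|F_n|$. A $G$-measure-preserving system $(X,\eta,\sigma)$ consists of a compact metric space $X$, a Borel probability measure $\eta$, and a measurable action $\sigma$ of $G$ on $X$ preserving $\eta$; it is ergodic if every $G$-invariant measurable set has measure $0$ or $1$. An ergodic Furstenberg system corresponding to $B$ is such an ergodic system $(X,\eta,\sigma)$ together with a measurable set $\tilde B\subset X$ satisfying $d^*(B\cap(B+h))\ge \eta(\tilde B\cap\sigma(h)\tilde B)$ for all $h\in G$ and $\eta(\tilde B)=d^*(B)$. Its spectral measure is the finite non-negative Borel measure $\nu$ on the dual group $\hat G$ with $\langle 1_{\tilde B},\sigma(h)1_{\tilde B}\rangle=\int_{\hat G}\chi(h)\,d\nu(\chi)$ for all $h\in G$ (given by Bochner's theorem), where $\langle f,\sigma(h)f\rangle=\int_X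 f(x)\overline{f(\sigma(h)x)}\,d\eta$-type Koopman inner product on $L^2(X,\eta)$. *)

theory Defs
  imports "HOL-Probability.Probability"
begin

definition Lam :: "(int^'n^'n) set" where
  "Lam = {A. trace A = 0}"

definition folner :: "(nat \<Rightarrow> (int^'n^'n) set) \<Rightarrow> bool" where
  "folner F \<longleftrightarrow>
     (\<forall>n. finite (F n) \<and> F n \<noteq> {} \<and> F n \<subseteq> Lam) \<and>
     (\<forall>g\<in>Lam. (\<lambda>n. real (card (F n \<inter> (\<lambda>x. x + g) ` F n)) / real (card (F n)))
                 \<longlonglongrightarrow> 1)"

definition upper_banach_density :: "(int^'n^'n) set \<Rightarrow> ereal" where
  "upper_banach_density B =
     (SUP F\<in>{F. folner F}. limsup (\<lambda>n. ereal (real (card (B \<inter> F n)) / real (card (F n)))))"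

definition mps :: "'x::metric_space set \<Rightarrow> 'x measure \<Rightarrow> (int^'n^'n \<Rightarrow> 'x \<Rightarrow> 'x) \<Rightarrow> bool" where
  "mps X M \<sigma> \<longleftrightarrow>
     compact X \<and> space M = X \<and> sets M = sets (restrict_space borel X) \<and> prob_space M \<and>
     (\<forall>x\<in>X. \<sigma> 0 x = x) \<and>
     (\<forall>g\<in>Lam. \<forall>h\<in>Lam. \<forall>x\<in>X. \<sigma> (g + h) x = \<sigma> g (\<sigma> h x)) \<and>
     (\<forall>g\<in>Lam. \<sigma> g \<in> measurable M M \<and>
        (\<forall>A\<in>sets M. emeasure M (\<sigma> g -` A \<inter> space M) = emeasure M A))"

definition ergodic_mps :: "'x::metric_space set \<Rightarrow> 'x measure \<Rightarrow> (int^'n^'n \<Rightarrow> 'x \<Rightarrow> 'x) \<Rightarrow> bool" where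
  "ergodic_mps X M \<sigma> \<longleftrightarrow> mps X M \<sigma> \<and>
     (\<forall>A\<in>sets M. (\<forall>g\<in>Lam. \<sigma> g -` A \<inter> space M = A) \<longrightarrow> measure M A = 0 \<or> measure M A = 1)"

definition ergodic_furstenberg_system ::
  "(int^'n^'n) set \<Rightarrow> 'x::metric_space set \<Rightarrow> 'x measure \<Rightarrow> (int^'n^'n \<Rightarrow> 'x \<Rightarrow> 'x) \<Rightarrow> 'x set \<Rightarrow> bool" where
  "ergodic_furstenberg_system B X M \<sigma> Bt \<longleftrightarrow>
     ergodic_mps X M \<sigma> \<and> Bt \<in> sets M \<and>
     (\<forall>h\<in>Lam. upper_banach_density (B \<inter> (\<lambda>b. b + h) ` B) \<ge> ereal (measure M (Bt \<inter> \<sigma> h ` Bt))) \<and>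
     ereal (measure M Bt) = upper_banach_density B"

text \<open>The dual group of Lam: characters Lam -> unit circle, encoded as functions on the whole
  matrix type which are 1 outside Lam; topology = pointwise convergence (product topology).\<close>
definition dual_group :: "(int^'n^'n \<Rightarrow> complex) set" where
  "dual_group = {\<xi>. (\<forall>g\<in>Lam. cmod (\<xi> g) = 1) \<and>
                    (\<forall>g\<in>Lam. \<forall>h\<in>Lam. \<xi> (g + h) = \<xi> g * \<xi> h) \<and>
                    (\<forall>g. g \<notin> Lam \<longrightarrow> \<xi> g = 1)}"

definition spectral_measure ::
  "'x measure \<Rightarrow> (int^'n^'n \<Rightarrow> 'x \<Rightarrow> 'x) \<Rightarrow> 'x set \<Rightarrow> (int^'n^'n \<Rightarrow> complex) measure \<Rightarrow> bool" where
  "spectral_measure M \<sigma> Bt \<nu> \<longleftrightarrow>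
     finite_measure \<nu> \<and> sets \<nu> = sets (restrict_space borel dual_group) \<and>
     (\<forall>h\<in>Lam. (\<integral>x. (indicator Bt x :: complex) * cnj (indicator Bt (\<sigma> h x)) \<partial>M)
                = (\<integral>\<xi>. \<xi> h \<partial>\<nu>))"

definition nontrivial_finite_order_character :: "(int^'n^'n \<Rightarrow> complex) \<Rightarrow> bool" where
  "nontrivial_finite_order_character \<xi> \<longleftrightarrow>
     \<xi> \<in> dual_group \<and> \<xi> \<noteq> (\<lambda>_. 1) \<and> (\<exists>n::nat. n > 0 \<and> (\<forall>g. \<xi> g ^ n = 1))"

end

theory Submission
  imports Defs
begin

text \<open>
  Let \<open>E = v w\<^sup>T\<close> with \<open>w\<^sup>T v = 0\<close>, \<open>F = 2E\<close> and \<open>g\<^sub>n = 1 + n F\<close>, which has determinant \<open>1\<close>. For every character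
  \<open>\<xi>\<close> the value at \<open>g\<^sub>n C g\<^sub>n\<inverse> = C + n [F, C] - n\<^sup>2 F C F\<close> is a quadratic phase in \<open>n\<close>, and
  \<open>F C F = 4 tr (C E) E\<close>. If \<open>tr (C E) \<noteq> 0\<close> and \<open>\<xi> E\<close> is not a root of unity, Weyl's theorem makes
  its averages vanish. So if no \<open>g\<^sub>n C g\<^sub>n\<inverse>\<close> lies in the difference set, integration against the
  spectral measure shows that the mass of the trivial character is at most the mass of the set
  \<open>S E\<close> of nontrivial characters \<open>\<xi>\<close> with \<open>\<xi> E\<close> a root of unity. On the other hand, by
  Cauchy--Schwarz along the multiples of \<open>E\<close>, the mass of the trivial character plus that of \<open>S E\<close>
  is at least the square of the measure of the set in the Furstenberg system.

  Now let \<open>E\<close> run through a polynomial curve \<open>t \<mapsto> E\<^sub>t\<close> of such matrices whose coefficients generate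
  the group of trace-zero matrices. A character with \<open>\<xi> E\<^sub>t\<close> a root of unity for infinitely many \<open>t\<close>
  has finite order, so the mass of \<open>S E\<^sub>t\<close> tends to \<open>0\<close>; the same principle applied to
  \<open>A \<mapsto> exp (tr (C A))\<close> gives \<open>tr (C E\<^sub>t) \<noteq> 0\<close> for all large \<open>t\<close> unless \<open>C = 0\<close>.
\<close>

subsection \<open>Roots of unity\<close>

text \<open>Defined over an arbitrary field because it is applied both to complex characters and to
  a real exponential.\<close>

definition root_of_unity :: "'a::field \<Rightarrow> bool" where
  "root_of_unity z \<longleftrightarrow> (\<exists>n>0. z ^ n = 1)"

lemma root_of_unity_1 [simp]: "root_of_unity 1"
  by (auto simp: root_of_unity_def)

lemma root_of_unity_mult:
  assumes "root_of_unity x" "root_of_unity y"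
  shows "root_of_unity (x * y)"
proof -
  from assms obtain m n where "m > 0" "x ^ m = 1" "n > 0" "y ^ n = 1"
    by (auto simp: root_of_unity_def)
  then have "m * n > 0" "(x * y) ^ (m * n) = 1"
    by (simp, metis (no_types, lifting) mult.commute mult_1 power_mult power_mult_distrib power_one)
  then show ?thesis unfolding root_of_unity_def by blast
qed

lemma root_of_unity_inverse_iff [simp]: "root_of_unity (inverse z) \<longleftrightarrow> root_of_unity z"
  by (simp add: root_of_unity_def power_inverse)

lemma root_of_unity_divide:
  "root_of_unity x \<Longrightarrow> root_of_unity y \<Longrightarrow> root_of_unity (x / y)"
  by (simp add: divide_inverse root_of_unity_mult)

lemma root_of_unity_power: "root_of_unity z \<Longrightarrow> root_of_unity (z ^ n)"
  by (induction n) (auto intro: root_of_unity_mult)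

lemma root_of_unity_power_cancel:
  assumes "root_of_unity (z ^ n)" "n > 0"
  shows "root_of_unity z"
proof -
  from assms(1) obtain m where "m > 0" "(z ^ n) ^ m = 1" by (auto simp: root_of_unity_def)
  then have "n * m > 0" "z ^ (n * m) = 1" using assms(2) by (simp_all add: power_mult)
  then show ?thesis unfolding root_of_unity_def by blast
qed

lemma root_of_unity_nonzero: "root_of_unity z \<Longrightarrow> z \<noteq> 0"
  by (auto simp: root_of_unity_def zero_power)

text \<open>Synthetic division by \<open>X - t\<^sub>0\<close>, written multiplicatively: the exponents of the quotient
  are read off from \<open>z m = y (m - 1) / y m ^ t\<^sub>0\<close>.\<close>
lemma synthetic_division_mult:
  fixes y z :: "nat \<Rightarrow> 'a::field"
  assumes y: "\<And>m. y m \<noteq> 0" and z0: "z 0 = r / y 0 ^ s"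
    and z: "\<And>m. z (Suc m) = y m / y (Suc m) ^ s"
  shows "(\<Prod>m\<le>M. z m ^ (t ^ m)) * y M ^ (t ^ M * s) = r * (\<Prod>k<M. y k ^ (t ^ k)) ^ t / (\<Prod>k<M. y k ^ (t ^ k)) ^ s"
proof (induction M)
  case 0
  then show ?case using y by (simp add: z0 field_simps)
next
  case (Suc M)
  let ?P = "\<Prod>k<M. y k ^ (t ^ k)"
  have nz: "?P \<noteq> 0" using y by simp
  have "(\<Prod>m\<le>Suc M. z m ^ (t ^ m)) * y (Suc M) ^ (t ^ Suc M * s)
      = (\<Prod>m\<le>M. z m ^ (t ^ m)) * y M ^ (t ^ Suc M)"
    using y by (simp add: z power_divide power_mult[symmetric] mult_ac)
  also have "\<dots> = ((\<Prod>m\<le>M. z m ^ (t ^ m)) * y M ^ (t ^ M * s)) * (y M ^ (t ^ M)) ^ t / (y M ^ (t ^ M)) ^ s"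
    using y by (simp add: power_mult[symmetric] mult_ac)
  also have "\<dots> = r * (\<Prod>k<Suc M. y k ^ (t ^ k)) ^ t / (\<Prod>k<Suc M. y k ^ (t ^ k)) ^ s"
    unfolding Suc.IH by (simp add: power_mult_distrib)
  finally show ?case .
qed

text \<open>Modulo roots of unity the multiplicative group is torsion-free, and the product is,
  additively, a polynomial in \<open>t\<close> with coefficients \<open>z m\<close>. So this says
  that a polynomial with infinitely many zeros has zero coefficients. Induction on the degree:
  divide by \<open>X - s\<close> at one zero \<open>s\<close>; the quotient vanishes at the
  remaining zeros.\<close>

lemma root_of_unity_poly_exponents:
  fixes z :: "nat \<Rightarrow> 'a::field"
  assumes "\<And>m. z m \<noteq> 0" "infinite T"
    and "\<And>t. t \<in> T \<Longrightarrow> root_of_unity (\<Prod>m\<le>M. z m ^ (t ^ m))"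
    and "m \<le> M"
  shows "root_of_unity (z m)"
  using assms
proof (induction M arbitrary: z T m)
  case 0
  then obtain t where "t \<in> T" by (metis finite.emptyI equals0I)
  with 0 show ?case by fastforce
next
  case (Suc M)
  obtain s where s: "s \<in> T" using Suc.prems(2) by (metis finite.emptyI equals0I)
  \<comment> \<open>\<open>y k\<close> is the coefficient of \<open>X ^ k\<close> in the quotient by
    \<open>X - s\<close>, in closed form.\<close>
  define y where "y k = (\<Prod>m\<in>{k<..Suc M}. z m ^ (s ^ (m - Suc k)))" for k
  have y_nz: "y k \<noteq> 0" for k using Suc.prems(1) by (simp add: y_def)
  have y_top: "y k = 1" if "k \<ge> Suc M" for k using that by (simp add: y_def)
  have z_y: "y k = z (Suc k) * y (Suc k) ^ s" if "k \<le> M" for k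
  proof -
    have "{k<..Suc M} = insert (Suc k) {Suc k<..Suc M}" using that by auto
    then have "y k = z (Suc k) * (\<Prod>m\<in>{Suc k<..Suc M}. z m ^ (s ^ (m - Suc k)))"
      by (simp add: y_def)
    also have "(\<Prod>m\<in>{Suc k<..Suc M}. z m ^ (s ^ (m - Suc k))) = y (Suc k) ^ s"
      unfolding y_def prod_power_distrib
    proof (rule prod.cong [OF refl])
      fix m assume "m \<in> {Suc k<..Suc M}"
      then have "m - Suc k = Suc (m - Suc (Suc k))" by auto
      then show "z m ^ s ^ (m - Suc k) = (z m ^ s ^ (m - Suc (Suc k))) ^ s"
        by (simp add: power_mult [symmetric] mult.commute)
    qed
    finally show ?thesis .
  qed
  \<comment> \<open>\<open>z'\<close> has the recursive form required by
    \<open>synthetic_division_mult\<close> at every index, whereas \<open>z\<close> satisfies it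
    only up to \<open>Suc M\<close>.\<close>
  define z' where "z' = case_nat (z 0) (\<lambda>m. y m / y (Suc m) ^ s)"
  have zz': "z' m = z m" if "m \<le> Suc M" for m
    using that y_nz z_y[of "m - 1"] by (cases m) (auto simp: z'_def)
  \<comment> \<open>The remainder of the division, that is, the value of the product at
    \<open>t = s\<close>.\<close>
  define r where "r = z 0 * y 0 ^ s"
  define Q where "Q t = (\<Prod>k\<le>M. y k ^ (t ^ k))" for t
  have Q_nz: "Q t \<noteq> 0" for t using y_nz by (simp add: Q_def)
  have P: "(\<Prod>m\<le>Suc M. z m ^ (t ^ m)) = r * Q t ^ t / Q t ^ s" for t
  proof -
    have "(\<Prod>m\<le>Suc M. z' m ^ (t ^ m)) * y (Suc M) ^ (t ^ Suc M * s)
        = r * (\<Prod>k<Suc M. y k ^ (t ^ k)) ^ t / (\<Prod>k<Suc M. y k ^ (t ^ k)) ^ s"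
      by (rule synthetic_division_mult) (use y_nz in \<open>auto simp: z'_def r_def\<close>)
    moreover have "(\<Prod>m\<le>Suc M. z' m ^ (t ^ m)) = (\<Prod>m\<le>Suc M. z m ^ (t ^ m))"
      by (rule prod.cong) (auto simp: zz')
    ultimately show ?thesis by (simp add: y_top Q_def lessThan_Suc_atMost)
  qed
  have r: "root_of_unity r"
    using Suc.prems(3)[OF s, unfolded P] Q_nz by simp
  \<comment> \<open>Dividing by \<open>r\<close> leaves \<open>Q t ^ (t - s)\<close>. Only
    \<open>t > s\<close> is used, so that this natural exponent is positive and can be
    cancelled.\<close>
  have "root_of_unity (Q t)" if "t \<in> T \<inter> {s<..}" for t
  proof -
    have "root_of_unity (r * Q t ^ t / Q t ^ s / r)"
      using Suc.prems(3)[of t, unfolded P] that r by (blast intro: root_of_unity_divide)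
    moreover have "r * Q t ^ t / Q t ^ s / r = Q t ^ (t - s)"
      using that Q_nz[of t] root_of_unity_nonzero[OF r] by (simp add: power_diff)
    ultimately show ?thesis using that by (intro root_of_unity_power_cancel[of "Q t" "t - s"]) auto
  qed
  moreover have "infinite (T \<inter> {s<..})"
  proof
    assume "finite (T \<inter> {s<..})"
    then have "finite ((T \<inter> {s<..}) \<union> {..s})" by simp
    moreover have "T \<subseteq> (T \<inter> {s<..}) \<union> {..s}" by auto
    ultimately show False using Suc.prems(2) finite_subset by blast
  qed
  ultimately have "root_of_unity (y k)" if "k \<le> M" for k
    using Suc.IH[of y "T \<inter> {s<..}" k] y_nz that by (auto simp: Q_def)
  then have y_ru: "root_of_unity (y k)" for k
    using y_top[of k] by (cases "k \<le> M") auto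
  have "root_of_unity (z' m)"
  proof (cases m)
    case 0
    have "z 0 = r / y 0 ^ s" using y_nz by (simp add: r_def)
    then show ?thesis using 0 r y_ru by (simp add: z'_def root_of_unity_divide root_of_unity_power)
  qed (simp add: z'_def root_of_unity_divide root_of_unity_power y_ru)
  then show ?case using zz' Suc.prems(4) by simp
qed

subsection \<open>Weyl sums\<close>

lemma geometric_averages_tendsto_0:
  fixes z :: complex
  assumes "cmod z = 1" "z \<noteq> 1"
  shows "(\<lambda>N. (\<Sum>n<N. z ^ n) / of_nat N) \<longlonglongrightarrow> 0"
proof (rule Lim_null_comparison)
  show "(\<lambda>N. 2 / cmod (z - 1) / real N) \<longlonglongrightarrow> 0"
    by (rule lim_const_over_n)
  have "norm ((\<Sum>n<N. z ^ n) / of_nat N) \<le> 2 / cmod (z - 1) / real N" for N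
  proof -
    have "cmod (z ^ N - 1) \<le> 2"
      using norm_triangle_ineq4[of "z ^ N" 1] assms by (simp add: norm_power)
    then show ?thesis
      using assms by (simp add: geometric_sum norm_divide divide_right_mono flip: divide_divide_eq_left)
  qed
  then show "\<forall>\<^sub>F N in sequentially. norm ((\<Sum>n<N. z ^ n) / of_nat N) \<le> 2 / cmod (z - 1) / real N"
    by simp
qed

text \<open>Each unit shift alters the sum by two boundary terms of norm at most 1.\<close>

lemma norm_shifted_sum_diff_le:
  fixes z :: "nat \<Rightarrow> 'a::real_normed_vector"
  assumes "\<And>n. norm (z n) \<le> 1"
  shows "norm ((\<Sum>n<N. z (n + h)) - (\<Sum>n<N. z n)) \<le> 2 * real h"
proof (induction h)
  case (Suc h)
  have "(\<Sum>n<N. z (n + Suc h)) - (\<Sum>n<N. z (n + h)) = z (N + h) - z h"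
    using sum_lessThan_telescope[of "\<lambda>n. z (n + h)" N] by (simp add: sum_subtractf)
  then have "norm ((\<Sum>n<N. z (n + Suc h)) - (\<Sum>n<N. z (n + h))) \<le> 2"
    using norm_triangle_ineq4[of "z (N + h)" "z h"] assms[of h] assms[of "N + h"] by simp
  with Suc show ?case
    using norm_triangle_ineq[of "(\<Sum>n<N. z (n + Suc h)) - (\<Sum>n<N. z (n + h))"
        "(\<Sum>n<N. z (n + h)) - (\<Sum>n<N. z n)"] by simp
qed simp

lemma cmod_sum_squared_le:
  fixes w :: "'b \<Rightarrow> complex"
  shows "(cmod (\<Sum>n\<in>A. w n))\<^sup>2 \<le> real (card A) * (\<Sum>n\<in>A. (cmod (w n))\<^sup>2)"
proof -
  have "(cmod (\<Sum>n\<in>A. w n))\<^sup>2 \<le> (\<Sum>n\<in>A. cmod (w n))\<^sup>2"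
    by (intro power_mono norm_sum norm_ge_zero)
  also have "\<dots> = (\<Sum>n\<in>A. 1 * cmod (w n))\<^sup>2" by simp
  also have "\<dots> \<le> (\<Sum>n\<in>A. 1\<^sup>2) * (\<Sum>n\<in>A. (cmod (w n))\<^sup>2)"
    by (rule Cauchy_Schwarz_ineq_sum)
  finally show ?thesis by simp
qed

text \<open>The average is compared with an average of window sums of length \<open>H\<close>. By
  Cauchy-Schwarz its square is bounded by the correlations: the diagonal ones contribute
  \<open>1 / H\<close>, the others tend to 0.\<close>

lemma van_der_Corput:
  fixes z :: "nat \<Rightarrow> complex"
  assumes bound: "\<And>n. cmod (z n) \<le> 1"
    and corr: "\<And>h k. h \<noteq> k \<Longrightarrow> (\<lambda>N. (\<Sum>n<N. z (n + h) * cnj (z (n + k))) / of_nat N) \<longlonglongrightarrow> 0"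
  shows "(\<lambda>N. (\<Sum>n<N. z n) / of_nat N) \<longlonglongrightarrow> 0"
proof (rule LIMSEQ_I)
  fix r :: real assume "r > 0"
  define \<epsilon> where "\<epsilon> = r / 2"
  have \<epsilon>: "\<epsilon> > 0" using \<open>r > 0\<close> by (simp add: \<epsilon>_def)
  \<comment> \<open>Half of the budget \<open>\<epsilon>\<^sup>2\<close> pays for the diagonal
    contribution \<open>1 / H\<close>, the other half for the off-diagonal sum
    \<open>D N\<close>.\<close>
  obtain H :: nat where H: "H > 0" "1 / real H < \<epsilon>\<^sup>2 / 2"
    using \<epsilon> by (metis inverse_eq_divide nat_approx_posE of_nat_0_less_iff half_gt_zero zero_less_Suc zero_less_power)
  define D where "D N = (\<Sum>(h, k)\<in>{..<H} \<times> {..<H} - Id. cmod ((\<Sum>n<N. z (n + h) * cnj (z (n + k))) / of_nat N))" for N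
  have "D \<longlonglongrightarrow> (\<Sum>(h, k)\<in>{..<H} \<times> {..<H} - Id. 0)"
    unfolding D_def using corr
    by (intro tendsto_sum) (auto intro!: tendsto_norm_zero)
  then have "D \<longlonglongrightarrow> 0" by simp
  then have "\<forall>\<^sub>F N in sequentially. D N < \<epsilon>\<^sup>2 / 2"
    using \<epsilon> by (intro order_tendstoD) auto
  moreover have "(\<lambda>N. 2 * real H / real N) \<longlonglongrightarrow> 0" by (rule lim_const_over_n)
  then have "\<forall>\<^sub>F N in sequentially. 2 * real H / real N < \<epsilon>"
    using \<epsilon> by (intro order_tendstoD) auto
  ultimately have "\<forall>\<^sub>F N in sequentially. cmod ((\<Sum>n<N. z n) / of_nat N) < r"
    using eventually_gt_at_top[of 0]
  proof eventually_elim
    case (elim N)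
    \<comment> \<open>Summing over the windows counts each \<open>z n\<close> about \<open>H\<close>
      times; every shift costs a boundary error of at most \<open>2 * H\<close>.\<close>
    define w where "w n = (\<Sum>h<H. z (n + h))" for n
    have "real H * cmod (\<Sum>n<N. z n) \<le> cmod (\<Sum>n<N. w n) + real H * (2 * real H)"
    proof -
      have "of_nat H * (\<Sum>n<N. z n) = (\<Sum>n<N. w n) - (\<Sum>h<H. (\<Sum>n<N. z (n + h)) - (\<Sum>n<N. z n))"
        unfolding w_def sum_subtractf by (subst sum.swap) simp
      moreover have "cmod (\<Sum>h<H. (\<Sum>n<N. z (n + h)) - (\<Sum>n<N. z n)) \<le> (\<Sum>h<H. 2 * real H)"
      proof (rule sum_norm_le)
        fix h assume "h \<in> {..<H}"
        then have "2 * real h \<le> 2 * real H" by simp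
        then show "cmod ((\<Sum>n<N. z (n + h)) - (\<Sum>n<N. z n)) \<le> 2 * real H"
          using norm_shifted_sum_diff_le[of z h N, OF bound] by linarith
      qed
      ultimately show ?thesis
        using norm_triangle_ineq4[of "\<Sum>n<N. w n" "\<Sum>h<H. (\<Sum>n<N. z (n + h)) - (\<Sum>n<N. z n)"]
        by (simp add: norm_mult [of "of_nat H", simplified, symmetric])
    qed
    then have 1: "cmod (\<Sum>n<N. z n) / real N \<le> cmod (\<Sum>n<N. w n) / (real H * real N) + 2 * real H / real N"
      using H(1) elim(3) by (simp add: field_simps)
    have "(cmod (\<Sum>n<N. w n))\<^sup>2 \<le> real N * (\<Sum>n<N. (cmod (w n))\<^sup>2)"
      using cmod_sum_squared_le[of w "{..<N}"] by simp
    also have "(\<Sum>n<N. (cmod (w n))\<^sup>2) \<le> real N * real H + real N * D N"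
    proof -
      have "complex_of_real (\<Sum>n<N. (cmod (w n))\<^sup>2) = (\<Sum>n<N. \<Sum>(h, k)\<in>{..<H} \<times> {..<H}. z (n + h) * cnj (z (n + k)))"
        by (simp add: w_def complex_norm_square sum_product sum.cartesian_product del: of_real_power)
      also have "\<dots> = (\<Sum>(h, k)\<in>{..<H} \<times> {..<H}. \<Sum>n<N. z (n + h) * cnj (z (n + k)))"
        by (subst sum.swap) (simp add: case_prod_unfold)
      also have "{..<H} \<times> {..<H} = (\<lambda>h. (h, h)) ` {..<H} \<union> ({..<H} \<times> {..<H} - Id)" by auto
      also have "(\<Sum>(h, k)\<in>(\<lambda>h. (h, h)) ` {..<H} \<union> ({..<H} \<times> {..<H} - Id). \<Sum>n<N. z (n + h) * cnj (z (n + k)))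
        = (\<Sum>h<H. \<Sum>n<N. z (n + h) * cnj (z (n + h))) + (\<Sum>(h, k)\<in>{..<H} \<times> {..<H} - Id. \<Sum>n<N. z (n + h) * cnj (z (n + k)))"
        by (subst sum.union_disjoint) (auto simp: sum.reindex inj_on_def)
      finally have eq: "complex_of_real (\<Sum>n<N. (cmod (w n))\<^sup>2) = \<dots>" .
      have "cmod (\<Sum>h<H. \<Sum>n<N. z (n + h) * cnj (z (n + h))) \<le> (\<Sum>h<H. \<Sum>n<N. 1)"
        using bound by (intro sum_norm_le) (simp add: norm_mult mult_le_one)
      moreover have "cmod (\<Sum>(h, k)\<in>{..<H} \<times> {..<H} - Id. \<Sum>n<N. z (n + h) * cnj (z (n + k))) \<le> real N * D N"
        unfolding D_def sum_distrib_left using elim(3)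
        by (intro sum_norm_le) (auto simp: norm_divide)
      ultimately have "cmod (complex_of_real (\<Sum>n<N. (cmod (w n))\<^sup>2)) \<le> real H * real N + real N * D N"
        unfolding eq by (intro norm_triangle_le add_mono) auto
      then show ?thesis unfolding norm_of_real by (simp add: sum_nonneg mult.commute)
    qed
    finally have "(cmod (\<Sum>n<N. w n))\<^sup>2 \<le> real N * (real N * real H + real N * D N)"
      by (simp add: mult_left_mono)
    then have "(cmod (\<Sum>n<N. w n) / (real H * real N))\<^sup>2 \<le> (1 / real H) + D N / (real H)\<^sup>2"
      using H(1) elim(3) by (simp add: power_divide field_simps power2_eq_square)
    also have "D N / (real H)\<^sup>2 \<le> D N"
    proof -
      have "D N \<ge> 0" by (auto simp: D_def intro!: sum_nonneg)
      moreover have "(real H)\<^sup>2 \<ge> 1" using H(1) by simp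
      ultimately show ?thesis using H(1) by (simp add: divide_le_eq mult_le_cancel_left1)
    qed
    finally have "(cmod (\<Sum>n<N. w n) / (real H * real N))\<^sup>2 < \<epsilon>\<^sup>2"
      using H(2) elim(1) by linarith
    then have "cmod (\<Sum>n<N. w n) / (real H * real N) < \<epsilon>"
      using \<epsilon> by (meson less_imp_le power_less_imp_less_base)
    with 1 elim(2) have "cmod (\<Sum>n<N. z n) / real N < 2 * \<epsilon>" by linarith
    then show ?case by (simp add: norm_divide \<epsilon>_def)
  qed
  then show "\<exists>N0. \<forall>N\<ge>N0. norm ((\<Sum>n<N. z n) / of_nat N - 0) < r"
    by (simp add: eventually_sequentially)
qed

text \<open>Two shifts \<open>h\<close> and \<open>k\<close> correlate to a constant times a
  geometric sequence, whose ratio is \<open>a\<close> to the power \<open>2 * (h - k)\<close>. It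
  differs from 1 because \<open>a\<close> is not a root of unity, so van der Corput applies.\<close>

lemma Weyl_quadratic:
  fixes a b c :: complex
  assumes "cmod c \<le> 1" "cmod b = 1" "cmod a = 1" "\<not> root_of_unity a"
  shows "(\<lambda>N. (\<Sum>n<N. c * b ^ n * a ^ (n\<^sup>2)) / of_nat N) \<longlonglongrightarrow> 0"
proof (rule van_der_Corput)
  show "cmod (c * b ^ n * a ^ (n\<^sup>2)) \<le> 1" for n
    using assms by (simp add: norm_mult norm_power)
next
  fix h k :: nat assume "h \<noteq> k"
  define q where "q = a ^ (2 * h) * cnj (a ^ (2 * k))"
  have unit: "a * cnj a = 1" "b * cnj b = 1"
    using assms by (simp_all add: complex_norm_square [symmetric])
  have "q \<noteq> 1"
  proof
    assume "q = 1"
    have "a ^ (2 * k) * cnj (a ^ (2 * k)) = 1"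
      using unit by (simp add: power_mult_distrib [symmetric])
    moreover have "a ^ (2 * k) * q = a ^ (2 * h) * (a ^ (2 * k) * cnj (a ^ (2 * k)))"
      by (simp add: q_def)
    ultimately have eq: "a ^ (2 * k) = a ^ (2 * h)" using \<open>q = 1\<close> by simp
    have a0: "a \<noteq> 0" using assms by auto
    have "root_of_unity a" if "a ^ m = a ^ n" "m < n" for m n
    proof -
      have "a ^ (n - m) = 1" using that a0 by (simp add: power_diff)
      then show ?thesis using that by (auto simp: root_of_unity_def intro!: exI[of _ "n - m"])
    qed
    then show False using eq \<open>h \<noteq> k\<close> assms(4) by (metis linorder_neqE_nat mult_less_cancel1 zero_less_numeral)
  qed
  moreover have "cmod q = 1" using assms by (simp add: q_def norm_mult norm_power)
  ultimately have lim: "(\<lambda>N. (\<Sum>n<N. q ^ n) / of_nat N) \<longlonglongrightarrow> 0"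
    by (intro geometric_averages_tendsto_0)
  define C where "C = c * cnj c * (b ^ h * cnj (b ^ k)) * (a ^ (h\<^sup>2) * cnj (a ^ (k\<^sup>2)))"
  have "c * b ^ (n + h) * a ^ ((n + h)\<^sup>2) * cnj (c * b ^ (n + k) * a ^ ((n + k)\<^sup>2)) = C * q ^ n" for n
  proof -
    have "c * b ^ (n + h) * a ^ ((n + h)\<^sup>2) * cnj (c * b ^ (n + k) * a ^ ((n + k)\<^sup>2))
      = (b * cnj b) ^ n * (a * cnj a) ^ (n\<^sup>2) * (C * q ^ n)"
      by (simp add: C_def q_def power2_sum power_add power_mult_distrib power_mult [symmetric] mult_ac)
    then show ?thesis by (simp add: unit)
  qed
  then have "(\<Sum>n<N. c * b ^ (n + h) * a ^ ((n + h)\<^sup>2) * cnj (c * b ^ (n + k) * a ^ ((n + k)\<^sup>2))) / of_nat N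
      = C * ((\<Sum>n<N. q ^ n) / of_nat N)" for N
    by (simp add: sum_distrib_left)
  then show "(\<lambda>N. (\<Sum>n<N. c * b ^ (n + h) * a ^ ((n + h)\<^sup>2) * cnj (c * b ^ (n + k) * a ^ ((n + k)\<^sup>2))) / of_nat N) \<longlonglongrightarrow> 0"
    using tendsto_mult_right_zero[OF lim] by presburger
qed

subsection \<open>Trace-zero matrices\<close>

lemma Lam_0: "0 \<in> Lam"
  by (simp add: Lam_def trace_def)

lemma Lam_add: "A \<in> Lam \<Longrightarrow> B \<in> Lam \<Longrightarrow> A + B \<in> Lam"
  by (simp add: Lam_def trace_add)

lemma Lam_diff: "A \<in> Lam \<Longrightarrow> B \<in> Lam \<Longrightarrow> A - B \<in> Lam"
  by (simp add: Lam_def trace_sub)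

lemma Lam_uminus: "A \<in> Lam \<Longrightarrow> - A \<in> Lam"
  using Lam_diff[OF Lam_0] by force

text \<open>The product \<open>*\<close> of matrices is entrywise and \<open>of_int n\<close> is
  constant, so \<open>of_int n * A\<close> is a scalar multiple; the matrix product is
  \<open>**\<close>.\<close>

lemma of_int_index: "(of_int n :: 'a::ring_1 ^ 'n) $ i = of_int n"
  by (cases n) (auto simp: of_nat_index)

lemma Lam_of_nat_mult: "A \<in> Lam \<Longrightarrow> of_nat n * A \<in> Lam"
  by (simp add: Lam_def trace_def of_nat_index flip: sum_distrib_left)

lemma subgroup_of_int_mult:
  assumes "0 \<in> S" "\<And>A B. A \<in> S \<Longrightarrow> B \<in> S \<Longrightarrow> A - B \<in> S" "A \<in> S"
  shows "of_int n * A \<in> (S :: (int^'n^'n) set)"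
proof -
  have um: "- B \<in> S" if "B \<in> S" for B using assms(1,2) that by force
  have ad: "A + B \<in> S" if "A \<in> S" "B \<in> S" for A B using assms(2)[OF that(1) um[OF that(2)]] by simp
  have nt: "of_nat n * A \<in> S" for n
    by (induction n) (use assms in \<open>auto simp: distrib_right intro: ad\<close>)
  show ?thesis
  proof (cases n)
    case (nonneg m)
    then show ?thesis using nt[of m] by simp
  next
    case (neg m)
    then show ?thesis using um[OF nt[of "Suc m"]] by (simp del: of_nat_Suc)
  qed
qed

lemma Lam_commutator: "A ** C - C ** A \<in> Lam"
  by (simp add: Lam_def trace_sub trace_mul_sym[of A C])

text \<open>Homomorphisms from the trace-zero matrices to the multiplicative group of a field, so
  that characters and exponentials of a trace are treated together. Nothing is demanded outside
  \<open>Lam\<close>.\<close>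

locale lam_hom =
  fixes \<phi> :: "int^'n^'n \<Rightarrow> 'b::field"
  assumes nonzero: "A \<in> Lam \<Longrightarrow> \<phi> A \<noteq> 0"
    and add: "A \<in> Lam \<Longrightarrow> B \<in> Lam \<Longrightarrow> \<phi> (A + B) = \<phi> A * \<phi> B"
begin

lemma zero [simp]: "\<phi> 0 = 1"
  using add[OF Lam_0 Lam_0] nonzero[OF Lam_0] by simp

lemma uminus: "A \<in> Lam \<Longrightarrow> \<phi> (- A) = inverse (\<phi> A)"
  using add[of A "- A"] Lam_uminus[of A] nonzero[of A] by (simp add: field_simps)

lemma diff: "A \<in> Lam \<Longrightarrow> B \<in> Lam \<Longrightarrow> \<phi> (A - B) = \<phi> A / \<phi> B"
  using add[of A "- B"] by (simp add: uminus Lam_uminus divide_inverse)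

lemma of_nat_mult: "A \<in> Lam \<Longrightarrow> \<phi> (of_nat n * A) = \<phi> A ^ n"
  by (induction n) (simp_all add: distrib_right add Lam_of_nat_mult)

lemma sum: "finite I \<Longrightarrow> (\<And>i. i \<in> I \<Longrightarrow> f i \<in> Lam) \<Longrightarrow> (\<Sum>i\<in>I. f i) \<in> Lam \<and> \<phi> (\<Sum>i\<in>I. f i) = (\<Prod>i\<in>I. \<phi> (f i))"
  by (induction I rule: finite_induct) (auto simp: Lam_0 add Lam_add)

lemma root_of_unity_of_int_mult_cancel:
  assumes "A \<in> Lam" "k \<noteq> 0" "root_of_unity (\<phi> (of_int k * A))"
  shows "root_of_unity (\<phi> A)"
proof (cases k)
  case (nonneg n)
  then show ?thesis using assms of_nat_mult[of A n]
    by (auto intro: root_of_unity_power_cancel)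
next
  case (neg n)
  have "of_int k * A = - (of_nat (Suc n) * A)" by (simp add: neg del: of_nat_Suc)
  then have "root_of_unity (\<phi> A ^ Suc n)"
    using assms of_nat_mult[of A "Suc n"] uminus[of "of_nat (Suc n) * A"] Lam_of_nat_mult[of A "Suc n"]
    by (simp del: of_nat_Suc power_Suc)
  then show ?thesis by (rule root_of_unity_power_cancel) simp
qed

end

subsection \<open>Conjugation by unipotent matrices\<close>

lemma matrix_add_rdistrib: "(A + B) ** C = A ** C + B ** (C :: int^'n^'m)"
  by (simp add: matrix_matrix_mult_def vec_eq_iff sum.distrib distrib_right)

lemma matrix_diff_ldistrib: "A ** (B - C) = A ** B - A ** (C :: int^'n^'m)"
  by (simp add: matrix_matrix_mult_def vec_eq_iff sum_subtractf right_diff_distrib)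

lemma matrix_diff_rdistrib: "(A - B) ** C = A ** C - B ** (C :: int^'n^'m)"
  by (simp add: matrix_matrix_mult_def vec_eq_iff sum_subtractf left_diff_distrib)

lemma of_nat_mult_matrix_left: "(of_nat n * A) ** C = of_nat n * (A ** (C :: int^'n^'m))"
  by (simp add: matrix_matrix_mult_def vec_eq_iff of_nat_index sum_distrib_left mult.assoc)

lemma of_nat_mult_matrix_right: "A ** (of_nat n * C) = of_nat n * (A ** (C :: int^'n^'m))"
  by (simp add: matrix_matrix_mult_def vec_eq_iff of_nat_index sum_distrib_left mult_ac)

lemmas matrix_distribs = matrix_add_ldistrib matrix_add_rdistrib matrix_diff_ldistrib
  matrix_diff_rdistrib of_nat_mult_matrix_left of_nat_mult_matrix_right

context
  fixes F :: "int^'n^'n"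
  assumes square_zero: "F ** F = 0"
begin

lemma unipotent_inverse:
  "(mat 1 + of_nat n * F) ** (mat 1 - of_nat n * F) = mat 1"
  "(mat 1 - of_nat n * F) ** (mat 1 + of_nat n * F) = mat 1"
  by (simp_all add: matrix_distribs square_zero)

lemma unipotent_conj:
  "(mat 1 + of_nat n * F) ** C ** (mat 1 - of_nat n * F)
    = C + of_nat n * (F ** C - C ** F) - of_nat (n\<^sup>2) * (F ** C ** F)"
  by (simp add: matrix_distribs matrix_mul_assoc) (simp add: power2_eq_square algebra_simps)

lemma Lam_square_zero_sandwich: "F ** C ** F \<in> Lam"
proof -
  have "trace (F ** C ** F) = trace (F ** (F ** C))" by (rule trace_mul_sym)
  also have "\<dots> = trace ((F ** F) ** C)" by (simp add: matrix_mul_assoc)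
  also have "\<dots> = 0" by (simp add: square_zero trace_def)
  finally show ?thesis by (simp add: Lam_def)
qed

text \<open>The doubling makes the matrix a square; the determinant of the root is a unit of the integers.\<close>
lemma det_unipotent_double: "det (mat 1 + of_nat n * (F + F)) = 1"
proof -
  let ?g = "mat 1 + of_nat n * F"
  have "det ?g * det (mat 1 - of_nat n * F) = 1"
    by (simp add: unipotent_inverse flip: det_mul)
  then have "det ?g = 1 \<or> det ?g = - 1" by (auto simp: zmult_eq_1_iff)
  moreover have "mat 1 + of_nat n * (F + F) = ?g ** ?g"
    by (simp add: matrix_distribs square_zero distrib_left)
  ultimately show ?thesis by (auto simp: det_mul)
qed

end

section \<open>Rank-one matrices: a column times a row\<close>

definition outer :: "int^'n \<Rightarrow> int^'n \<Rightarrow> int^'n^'n" where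
  "outer v w = (\<chi> i j. v $ i * w $ j)"

lemma trace_mult_outer: "trace (C ** outer v w) = (\<Sum>i\<in>UNIV. \<Sum>j\<in>UNIV. w $ i * C $ i $ j * v $ j)"
  by (simp add: trace_def matrix_matrix_mult_def outer_def mult_ac)

text \<open>The middle factor, row times \<open>C\<close> times column, is a scalar. Hence the
  quadratic coefficient of the conjugates is an integer multiple of the rank-one matrix
  itself.\<close>

lemma outer_sandwich: "outer v w ** C ** outer v w = of_int (trace (C ** outer v w)) * outer v w"
proof -
  have "(outer v w ** C ** outer v w) $ a $ b = (of_int (trace (C ** outer v w)) * outer v w) $ a $ b" for a b
  proof -
    have "(outer v w ** C ** outer v w) $ a $ b
        = (\<Sum>j\<in>UNIV. \<Sum>i\<in>UNIV. v $ a * w $ b * (w $ i * C $ i $ j * v $ j))"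
      by (simp add: matrix_matrix_mult_def outer_def sum_distrib_left sum_distrib_right mult_ac)
    also have "\<dots> = v $ a * w $ b * trace (C ** outer v w)"
      by (subst sum.swap) (simp add: trace_mult_outer sum_distrib_left)
    finally show ?thesis by (simp add: of_int_index outer_def)
  qed
  then show ?thesis by (simp add: vec_eq_iff)
qed

lemma outer_square: "(\<Sum>i\<in>UNIV. w $ i * v $ i) = 0 \<Longrightarrow> outer v w ** outer v w = 0"
proof -
  assume *: "(\<Sum>i\<in>UNIV. w $ i * v $ i) = 0"
  have "(outer v w ** outer v w) $ a $ b = v $ a * w $ b * (\<Sum>i\<in>UNIV. w $ i * v $ i)" for a b
    by (simp add: matrix_matrix_mult_def outer_def sum_distrib_left mult_ac)
  then show ?thesis by (simp add: vec_eq_iff *)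
qed

subsection \<open>A curve of nilpotent matrices of rank one\<close>

text \<open>The index type carries no order; \<open>e\<close> numbers it by \<open>0\<close> to
  \<open>d - 1\<close>, so that indices can serve as exponents.\<close>

locale enumerated =
  fixes e :: "'n::finite \<Rightarrow> nat" and d :: nat
  assumes bij: "bij_betw e UNIV {..<d}" and d: "d \<ge> 2"
begin

text \<open>The indices range over all naturals. Out of range the matrix is zero, which absorbs the
  boundary case of row \<open>d\<close>.\<close>

definition unit_matrix :: "nat \<Rightarrow> nat \<Rightarrow> int^'n^'n" where
  "unit_matrix p q = (\<chi> i j. if e i = p \<and> e j = q then 1 else 0)"

text \<open>Here \<open>v = (t\<^bsup>i\<^esup>)\<^sub>i\<close> and \<open>w = \<Sum>\<^sub>p t\<^bsup>p (d + 1)\<^esup> (t e\<^sub>p - e\<^sub>p\<^sub>+\<^sub>1)\<close>, a combination of the obvious relations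
  between consecutive entries of \<open>v\<close>. The weights \<open>t\<^bsup>p (d + 1)\<^esup>\<close> keep all \<open>(d - 1) (d + 1)\<close> monomials
  of \<open>v w\<^sup>T\<close> distinct, so that its coefficients form a basis of the trace-zero matrices.\<close>
definition curve_fst :: "nat \<Rightarrow> int^'n" where
  "curve_fst t = (\<chi> i. int t ^ e i)"

definition curve_snd :: "nat \<Rightarrow> int^'n" where
  "curve_snd t = (\<chi> j. \<Sum>p<d - 1. int t ^ (p * Suc d) *
     ((if e j = p then int t else 0) - (if e j = Suc p then 1 else 0)))"

definition curve :: "nat \<Rightarrow> int^'n^'n" where
  "curve t = outer (curve_fst t) (curve_snd t)"

text \<open>The coefficient of \<open>t ^ m\<close> in the curve. With
  \<open>m = p * Suc d + k\<close>, the block \<open>p\<close> belongs to the relation between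
  entries \<open>p\<close> and \<open>p + 1\<close>, and \<open>k\<close> is the exponent inside the
  block. For \<open>k = 0\<close> only its second term occurs; for \<open>k = d\<close> the second
  unit matrix lies in row \<open>d\<close> and vanishes.\<close>

definition curve_coeff :: "nat \<Rightarrow> int^'n^'n" where
  "curve_coeff m = (case m mod Suc d of
      0 \<Rightarrow> - unit_matrix 0 (Suc (m div Suc d))
    | Suc k \<Rightarrow> unit_matrix k (m div Suc d) - unit_matrix (Suc k) (Suc (m div Suc d)))"

lemma e_less: "e i < d"
  using bij by (auto simp: bij_betw_def)

lemma e_eq_iff: "e i = e j \<longleftrightarrow> i = j"
  using bij by (auto simp: bij_betw_def inj_on_def)

lemma sum_e: "(\<Sum>i\<in>UNIV. f (e i)) = (\<Sum>k<d. f k)"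
  using sum.reindex_bij_betw[OF bij] by simp

text \<open>Each relation \<open>p\<close> contributes \<open>t * t ^ p - t ^ Suc p\<close>.\<close>

lemma curve_orthogonal: "(\<Sum>i\<in>UNIV. curve_snd t $ i * curve_fst t $ i) = 0"
proof -
  have "(\<Sum>i\<in>UNIV. curve_snd t $ i * curve_fst t $ i)
    = (\<Sum>k<d. (\<Sum>p<d - 1. int t ^ (p * Suc d) * ((if k = p then int t else 0) - (if k = Suc p then 1 else 0))) * int t ^ k)"
    unfolding curve_fst_def curve_snd_def by (simp add: sum_e[symmetric] del: mult_Suc_right)
  also have "\<dots> = (\<Sum>p<d - 1. \<Sum>k<d. int t ^ (p * Suc d) * ((if k = p then int t * int t ^ k else 0) - (if k = Suc p then int t ^ k else 0)))"
    unfolding sum_distrib_right by (subst sum.swap) (intro sum.cong refl, auto)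
  also have "\<dots> = (\<Sum>p<d - 1. 0)"
    by (intro sum.cong refl) (auto simp: sum_subtractf simp flip: sum_distrib_left)
  finally show ?thesis by simp
qed

lemma curve_square: "curve t ** curve t = 0"
  unfolding curve_def by (rule outer_square[OF curve_orthogonal])

lemma curve_in_Lam: "curve t \<in> Lam"
  using curve_orthogonal[of t] by (simp add: Lam_def trace_def curve_def outer_def mult.commute)

lemma curve_sandwich: "curve t ** C ** curve t = of_int (trace (C ** curve t)) * curve t"
  unfolding curve_def by (rule outer_sandwich)

lemma curve_expansion: "curve t = (\<Sum>m<(d - 1) * Suc d. of_nat (t ^ m) * curve_coeff m)"
proof -
  have "(\<Sum>m<(d - 1) * Suc d. of_nat (t ^ m) * curve_coeff m) $ i $ j = curve t $ i $ j" for i j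
  proof -
    \<comment> \<open>The \<open>d + 1\<close> exponents of block \<open>p\<close> together yield
      the contribution of relation \<open>p\<close> to the entry.\<close>
    have inner: "(\<Sum>k<Suc d. int t ^ (p * Suc d + k) * curve_coeff (p * Suc d + k) $ i $ j)
        = int t ^ (p * Suc d) * (int t ^ e i * ((if e j = p then int t else 0) - (if e j = Suc p then 1 else 0)))" for p
    proof -
      have "(\<Sum>k<Suc d. int t ^ k * curve_coeff (p * Suc d + k) $ i $ j)
         = - unit_matrix 0 (Suc p) $ i $ j + (\<Sum>k<d. int t ^ Suc k * (unit_matrix k p $ i $ j - unit_matrix (Suc k) (Suc p) $ i $ j))"
      proof -
        have "curve_coeff (p * Suc d + 0) = - unit_matrix 0 (Suc p)"
          by (simp add: curve_coeff_def del: mult_Suc_right)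
        moreover have "curve_coeff (p * Suc d + Suc k) = unit_matrix k p - unit_matrix (Suc k) (Suc p)" if "k < d" for k
        proof -
          have "(p * Suc d + Suc k) mod Suc d = Suc k" "(p * Suc d + Suc k) div Suc d = p"
            using that by (simp_all del: mult_Suc_right add_Suc_right)
          then show ?thesis by (simp add: curve_coeff_def)
        qed
        ultimately show ?thesis
          by (subst sum.lessThan_Suc_shift) (auto intro!: sum.cong simp del: mult_Suc_right add_Suc_right)
      qed
      also have "\<dots> = int t ^ e i * ((if e j = p then int t else 0) - (if e j = Suc p then 1 else 0))"
      proof -
        have 1: "(\<Sum>k<d. int t ^ Suc k * unit_matrix k p $ i $ j) = (if e j = p then int t ^ Suc (e i) else 0)"
        proof -
          have "(\<Sum>k<d. int t ^ Suc k * unit_matrix k p $ i $ j) = (\<Sum>k<d. if k = e i then (if e j = p then int t ^ Suc (e i) else 0) else 0)"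
            by (intro sum.cong) (auto simp: unit_matrix_def)
          then show ?thesis using e_less[of i] by simp
        qed
        \<comment> \<open>The separate first term is the missing \<open>k = 0\<close> term of the
          shifted sum; afterwards only \<open>k = e i\<close> survives.\<close>
        have 2: "unit_matrix 0 (Suc p) $ i $ j + (\<Sum>k<d. int t ^ Suc k * unit_matrix (Suc k) (Suc p) $ i $ j) = (if e j = Suc p then int t ^ e i else 0)"
        proof -
          have "unit_matrix 0 (Suc p) $ i $ j + (\<Sum>k<d. int t ^ Suc k * unit_matrix (Suc k) (Suc p) $ i $ j)
              = (\<Sum>k<Suc d. int t ^ k * unit_matrix k (Suc p) $ i $ j)"
            by (subst sum.lessThan_Suc_shift) simp
          also have "\<dots> = (\<Sum>k<Suc d. if k = e i then (if e j = Suc p then int t ^ e i else 0) else 0)"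
            by (intro sum.cong) (auto simp: unit_matrix_def)
          finally show ?thesis using e_less[of i] by simp
        qed
        have "- unit_matrix 0 (Suc p) $ i $ j + (\<Sum>k<d. int t ^ Suc k * (unit_matrix k p $ i $ j - unit_matrix (Suc k) (Suc p) $ i $ j))
          = (\<Sum>k<d. int t ^ Suc k * unit_matrix k p $ i $ j)
            - (unit_matrix 0 (Suc p) $ i $ j + (\<Sum>k<d. int t ^ Suc k * unit_matrix (Suc k) (Suc p) $ i $ j))"
          unfolding right_diff_distrib sum_subtractf by simp
        also have "\<dots> = int t ^ e i * ((if e j = p then int t else 0) - (if e j = Suc p then 1 else 0))"
          unfolding 1 2 by simp
        finally show ?thesis .
      qed
      finally show ?thesis
        by (simp add: power_add mult.assoc del: mult_Suc_right sum.lessThan_Suc flip: sum_distrib_left)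
    qed
    have "(\<Sum>m<(d - 1) * Suc d. of_nat (t ^ m) * curve_coeff m) $ i $ j
        = (\<Sum>m<(d - 1) * Suc d. int t ^ m * curve_coeff m $ i $ j)"
      by (simp add: of_nat_index del: of_nat_power mult_Suc_right) simp
    also have "\<dots> = (\<Sum>p<d - 1. \<Sum>k<Suc d. int t ^ (p * Suc d + k) * curve_coeff (p * Suc d + k) $ i $ j)"
    proof -
      have "(\<Sum>p<d - 1. \<Sum>m\<in>{p * Suc d..<p * Suc d + Suc d}. int t ^ m * curve_coeff m $ i $ j)
        = (\<Sum>m<(d - 1) * Suc d. int t ^ m * curve_coeff m $ i $ j)"
        by (rule sum.nat_group)
      moreover have "(\<Sum>m\<in>{p * Suc d..<p * Suc d + Suc d}. int t ^ m * curve_coeff m $ i $ j)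
        = (\<Sum>k<Suc d. int t ^ (p * Suc d + k) * curve_coeff (p * Suc d + k) $ i $ j)" for p
        using sum.shift_bounds_nat_ivl[of "\<lambda>m. int t ^ m * curve_coeff m $ i $ j" 0 "p * Suc d" "Suc d"]
        by (simp only: add_0 atLeast0LessThan add.commute)
      ultimately show ?thesis by simp
    qed
    also have "\<dots> = curve t $ i $ j"
      unfolding inner curve_def outer_def curve_fst_def curve_snd_def
      by (simp add: sum_distrib_left mult_ac del: mult_Suc_right)
    finally show ?thesis .
  qed
  then show ?thesis by (simp add: vec_eq_iff)
qed

text \<open>Differences of consecutive unit matrices allow moves along diagonals. Diagonals above
  the main one start at a unit matrix in row 0, itself a coefficient up to sign; those below run
  into the zero row \<open>d\<close>. On the main diagonal only differences from
  \<open>unit_matrix 0 0\<close> are reached, which suffices for trace zero.\<close>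

lemma curve_coeff_generate:
  assumes zero: "0 \<in> S" and diff: "\<And>A B. A \<in> S \<Longrightarrow> B \<in> S \<Longrightarrow> A - B \<in> S"
    and coeff: "\<And>m. m < (d - 1) * Suc d \<Longrightarrow> curve_coeff m \<in> S"
  shows "Lam \<subseteq> S"
proof
  fix A :: "int^'n^'n" assume A: "A \<in> Lam"
  have um: "- B \<in> S" if "B \<in> S" for B using zero diff that by force
  have ad: "A + B \<in> S" if "A \<in> S" "B \<in> S" for A B using diff[OF that(1) um[OF that(2)]] by simp
  have bound: "p * Suc d + k < (d - 1) * Suc d" if "p < d - 1" "k \<le> d" for p k
  proof -
    have "p * Suc d + k < Suc p * Suc d" using that by simp
    also have "\<dots> \<le> (d - 1) * Suc d" using that by (intro mult_le_mono1) simp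
    finally show ?thesis .
  qed
  have first: "unit_matrix 0 (Suc p) \<in> S" if "p < d - 1" for p
  proof -
    have "curve_coeff (p * Suc d) \<in> S" using bound[of p 0] that by (intro coeff) simp
    moreover have "(p * Suc d) mod Suc d = 0" "(p * Suc d) div Suc d = p"
      by (simp_all del: mult_Suc_right)
    ultimately have "- unit_matrix 0 (Suc p) \<in> S"
      by (simp add: curve_coeff_def del: mult_Suc_right)
    from um[OF this] show ?thesis by simp
  qed
  have shift: "unit_matrix k p - unit_matrix (Suc k) (Suc p) \<in> S" if "p < d - 1" "k < d" for p k
  proof -
    have "curve_coeff (p * Suc d + Suc k) \<in> S" using bound[of p "Suc k"] that by (intro coeff) simp
    moreover have "(p * Suc d + Suc k) mod Suc d = Suc k" "(p * Suc d + Suc k) div Suc d = p"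
      using that by (simp_all del: mult_Suc_right add_Suc_right)
    ultimately show ?thesis by (simp add: curve_coeff_def)
  qed
  have upper: "unit_matrix i j \<in> S" if "i < j" "j < d" for i j
    using that
  proof (induction i arbitrary: j)
    case 0
    then show ?case using first[of "j - 1"] by simp
  next
    case (Suc i)
    then have "unit_matrix i (j - 1) \<in> S" "unit_matrix i (j - 1) - unit_matrix (Suc i) (Suc (j - 1)) \<in> S"
      using shift[of "j - 1" i] by auto
    from diff[OF this] show ?case using Suc.prems by simp
  qed
  \<comment> \<open>The downward induction starts at row \<open>d\<close>, one past the last, where
    the unit matrix is zero.\<close>
  have lower: "unit_matrix i j \<in> S" if "j < i" "i \<le> d" for i j
    using that(2,1)
  proof (induction i arbitrary: j rule: inc_induct)
    case base
    have "unit_matrix d j = 0"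
      using e_less by (auto simp: unit_matrix_def vec_eq_iff less_le)
    then show ?case using zero by simp
  next
    case (step i)
    then have "unit_matrix i j - unit_matrix (Suc i) (Suc j) \<in> S" "unit_matrix (Suc i) (Suc j) \<in> S"
      using shift[of j i] by auto
    from ad[OF this] show ?case by simp
  qed
  have diag: "unit_matrix i i - unit_matrix 0 0 \<in> S" if "i < d" for i
    using that
  proof (induction i)
    case (Suc i)
    then have "unit_matrix i i - unit_matrix 0 0 \<in> S" "unit_matrix i i - unit_matrix (Suc i) (Suc i) \<in> S"
      using shift[of i i] by auto
    from diff[OF this] show ?case by simp
  qed (simp add: zero)
  have sm: "(\<Sum>i\<in>I. f i) \<in> S" if "finite I" "\<And>i. i \<in> I \<Longrightarrow> f i \<in> S" for I :: "'n set" and f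
    using that by (induction I rule: finite_induct) (auto simp: zero ad)
  \<comment> \<open>The corrections on the diagonal add up to the trace of \<open>A\<close> times
    \<open>unit_matrix 0 0\<close>, hence to zero.\<close>
  have "(\<Sum>i\<in>UNIV. \<Sum>j\<in>UNIV. of_int (A $ i $ j) * (unit_matrix (e i) (e j) - (if i = j then unit_matrix 0 0 else 0))) \<in> S"
  proof (intro sm)
    fix i j
    have "unit_matrix (e i) (e j) - (if i = j then unit_matrix 0 0 else 0) \<in> S"
      using upper[of "e i" "e j"] lower[of "e j" "e i"] diag[of "e i"] e_less[of i] e_less[of j] e_eq_iff[of i j]
      by (auto simp: less_le) (metis less_le nat_neq_iff)
    then show "of_int (A $ i $ j) * (unit_matrix (e i) (e j) - (if i = j then unit_matrix 0 0 else 0)) \<in> S"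
      using subgroup_of_int_mult zero diff by blast
  qed simp_all
  also have "(\<Sum>i\<in>UNIV. \<Sum>j\<in>UNIV. of_int (A $ i $ j) * (unit_matrix (e i) (e j) - (if i = j then unit_matrix 0 0 else 0))) = A"
  proof -
    have "(\<Sum>i\<in>UNIV. \<Sum>j\<in>UNIV. of_int (A $ i $ j) * (unit_matrix (e i) (e j) - (if i = j then unit_matrix 0 0 else 0))) $ a $ b = A $ a $ b" for a b
    proof -
      have "(\<Sum>i\<in>UNIV. \<Sum>j\<in>UNIV. of_int (A $ i $ j) * (unit_matrix (e i) (e j) - (if i = j then unit_matrix 0 0 else 0))) $ a $ b
        = (\<Sum>i\<in>UNIV. \<Sum>j\<in>UNIV. (if j = b then (if i = a then A $ i $ j else 0) else 0) - (if i = j then A $ i $ i * unit_matrix 0 0 $ a $ b else 0))"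
        by (simp add: of_int_index) (intro sum.cong refl, auto simp: unit_matrix_def e_eq_iff)
      also have "\<dots> = A $ a $ b - (\<Sum>i\<in>UNIV. A $ i $ i) * unit_matrix 0 0 $ a $ b"
        by (simp add: sum_subtractf sum_distrib_right)
      also have "(\<Sum>i\<in>UNIV. A $ i $ i) = 0" using A by (simp add: Lam_def trace_def)
      finally show ?thesis by simp
    qed
    then show ?thesis by (simp add: vec_eq_iff)
  qed
  finally show "A \<in> S" .
qed

text \<open>The bound on \<open>m\<close> keeps the column \<open>Suc (m div Suc d)\<close> below
  \<open>d\<close>, so that two diagonal units always cancel in the trace.\<close>

lemma curve_coeff_in_Lam: "curve_coeff m \<in> Lam" if "m < (d - 1) * Suc d"
proof -
  have p: "m div Suc d < d - 1" using that by (simp add: less_mult_imp_div_less del: mult_Suc_right)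
  have tr: "trace (unit_matrix a b) = (if a = b \<and> a < d then 1 else 0)" for a b
  proof -
    have "trace (unit_matrix a b) = (\<Sum>k<d. if k = a then (if a = b then 1 else 0) else 0)"
      unfolding sum_e[symmetric] trace_def unit_matrix_def by (intro sum.cong) auto
    then show ?thesis by auto
  qed
  have tm: "trace (- unit_matrix a b) = - trace (unit_matrix a b)" for a b
    by (simp add: trace_def sum_negf)
  show ?thesis
    using p by (auto simp: curve_coeff_def Lam_def trace_sub tr tm split: nat.split)
qed

end

section \<open>Homomorphisms that are torsion along the curve\<close>

locale enumerated_hom = enumerated e d + lam_hom \<phi>
  for e :: "'n::finite \<Rightarrow> nat" and d and \<phi> :: "int^'n^'n \<Rightarrow> 'b::field"
begin

text \<open>The product of the orders on the finitely many generators is a common exponent.\<close>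

lemma finite_order:
  assumes "\<And>m. m < (d - 1) * Suc d \<Longrightarrow> root_of_unity (\<phi> (curve_coeff m))"
  shows "\<exists>n>0. \<forall>A\<in>Lam. \<phi> A ^ n = 1"
proof -
  obtain ord_of where ord_of: "\<And>m. m < (d - 1) * Suc d \<Longrightarrow> ord_of m > 0 \<and> \<phi> (curve_coeff m) ^ ord_of m = 1"
    using assms unfolding root_of_unity_def by metis
  define n where "n = (\<Prod>m<(d - 1) * Suc d. ord_of m)"
  have n: "n > 0" using ord_of by (auto simp: n_def)
  have "Lam \<subseteq> {A \<in> Lam. \<phi> A ^ n = 1}"
  proof (rule curve_coeff_generate)
    fix m assume m: "m < (d - 1) * Suc d"
    then have "ord_of m dvd n" by (auto simp: n_def intro!: dvd_prodI)
    then obtain k where "n = ord_of m * k" ..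
    then have "\<phi> (curve_coeff m) ^ n = 1" using ord_of[OF m] by (simp add: power_mult)
    then show "curve_coeff m \<in> {A \<in> Lam. \<phi> A ^ n = 1}" using curve_coeff_in_Lam[OF m] by simp
  qed (auto simp: Lam_0 Lam_diff diff power_divide)
  then show ?thesis using n by blast
qed

text \<open>The image of \<open>curve t\<close> is a product of powers of the images of the
  coefficients with exponents \<open>t ^ m\<close>, so \<open>root_of_unity_poly_exponents\<close>
  makes the image of every generator torsion.\<close>

lemma finite_order_if_infinitely_often_torsion:
  assumes "infinite {t. root_of_unity (\<phi> (curve t))}"
  shows "\<exists>n>0. \<forall>A\<in>Lam. \<phi> A ^ n = 1"
proof (rule finite_order)
  fix m assume m: "m < (d - 1) * Suc d"
  define K where "K = (d - 1) * Suc d"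
  \<comment> \<open>The value 1 pads the product, which runs up to and including \<open>K\<close>,
    and keeps \<open>z\<close> nonzero at every index.\<close>
  define z where "z m = (if m < K then \<phi> (curve_coeff m) else 1)" for m
  have "root_of_unity (z m)"
  proof (rule root_of_unity_poly_exponents[OF _ assms])
    show "z m \<noteq> 0" for m using nonzero curve_coeff_in_Lam by (auto simp: z_def K_def)
    show "m \<le> K" using m by (simp add: K_def)
    fix t assume "t \<in> {t. root_of_unity (\<phi> (curve t))}"
    moreover have "\<phi> (curve t) = (\<Prod>m<K. \<phi> (of_nat (t ^ m) * curve_coeff m))"
      unfolding curve_expansion K_def[symmetric]
      by (rule conjunct2[OF sum]) (auto simp: K_def Lam_of_nat_mult curve_coeff_in_Lam simp del: of_nat_power)
    moreover have "(\<Prod>m<K. \<phi> (of_nat (t ^ m) * curve_coeff m)) = (\<Prod>m<K. z m ^ (t ^ m))"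
      by (intro prod.cong refl, subst of_nat_mult) (auto simp: z_def K_def curve_coeff_in_Lam)
    moreover have "(\<Prod>m\<le>K. z m ^ (t ^ m)) = (\<Prod>m<K. z m ^ (t ^ m))"
      unfolding lessThan_Suc_atMost[symmetric] by (simp add: z_def)
    ultimately show "root_of_unity (\<Prod>m\<le>K. z m ^ (t ^ m))" by simp
  qed
  then show "root_of_unity (\<phi> (curve_coeff m))" using m by (simp add: z_def K_def del: mult_Suc_right)
qed

end

section \<open>Nondegeneracy of the trace pairing\<close>

context enumerated
begin

text \<open>Off-diagonal units kill the off-diagonal entries of \<open>C\<close>, and differences of
  diagonal units make \<open>C\<close> scalar. A scalar integer matrix of trace zero
  vanishes.\<close>

lemma trace_pairing_nondegenerate:
  fixes C :: "int^'n^'n"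
  assumes "C \<in> Lam" "\<And>A. A \<in> Lam \<Longrightarrow> trace (C ** A) = 0"
  shows "C = 0"
proof -
  have tr: "trace (C ** unit_matrix (e j) (e i)) = C $ i $ j" for i j :: 'n
  proof -
    have "trace (C ** unit_matrix (e j) (e i)) = (\<Sum>a\<in>UNIV. \<Sum>b\<in>UNIV. C $ a $ b * (if b = j \<and> a = i then 1 else 0))"
      unfolding trace_def matrix_matrix_mult_def unit_matrix_def by (simp add: e_eq_iff)
    also have "\<dots> = (\<Sum>a\<in>UNIV. \<Sum>b\<in>UNIV. if b = j then (if a = i then C $ i $ j else 0) else 0)"
      by (intro sum.cong refl) auto
    finally show ?thesis by simp
  qed
  have un: "trace (unit_matrix (e j) (e i)) = (if i = j then 1 else 0)" for i j
    unfolding trace_def unit_matrix_def by (auto simp: e_eq_iff intro: sum.neutral)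
  have off: "C $ i $ j = 0" if "i \<noteq> j" for i j
    using assms(2)[of "unit_matrix (e j) (e i)"] that by (simp add: Lam_def un tr)
  have diag: "C $ i $ i = C $ j $ j" for i j
    using assms(2)[of "unit_matrix (e i) (e i) - unit_matrix (e j) (e j)"]
    by (simp add: Lam_def un tr trace_sub matrix_diff_ldistrib)
  have "C $ i $ i = 0" for i
  proof -
    have "0 = (\<Sum>j\<in>UNIV. C $ j $ j)" using assms(1) by (simp add: Lam_def trace_def)
    also have "\<dots> = (\<Sum>j\<in>(UNIV :: 'n set). C $ i $ i)" using diag by (intro sum.cong) auto
    finally show ?thesis by simp
  qed
  with off show ?thesis by (auto simp: vec_eq_iff) (metis)
qed

text \<open>The exponential turns the trace functional into a homomorphism to the positive reals,
  where 1 is the only root of unity. Infinitely many zeros along the curve would make the functional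
  vanish on \<open>Lam\<close>.\<close>

lemma finite_trace_curve_zero:
  assumes "C \<in> Lam" "C \<noteq> 0"
  shows "finite {t. trace (C ** curve t) = 0}"
proof (rule ccontr)
  assume inf: "infinite {t. trace (C ** curve t) = 0}"
  define \<phi> :: "int^'n^'n \<Rightarrow> real" where "\<phi> A = exp (of_int (trace (C ** A)))" for A
  interpret enumerated_hom e d \<phi>
    by unfold_locales (simp_all add: \<phi>_def matrix_add_ldistrib trace_add exp_add)
  have "infinite {t. root_of_unity (\<phi> (curve t))}"
    using inf by (rule infinite_super[rotated]) (auto simp: \<phi>_def)
  then obtain n where "n > 0" "\<forall>A\<in>Lam. \<phi> A ^ n = 1"
    using finite_order_if_infinitely_often_torsion by blast
  then have "trace (C ** A) = 0" if "A \<in> Lam" for A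
    using that by (auto simp: \<phi>_def exp_of_nat_mult [symmetric])
  then show False using trace_pairing_nondegenerate assms by blast
qed

end

subsection \<open>Characters\<close>

lemma lam_hom_dual: "\<xi> \<in> dual_group \<Longrightarrow> lam_hom \<xi>"
  by unfold_locales (auto simp: dual_group_def)

lemma cmod_dual: "\<xi> \<in> dual_group \<Longrightarrow> cmod (\<xi> g) = 1"
  by (cases "g \<in> Lam") (auto simp: dual_group_def)

lemma one_in_dual_group: "(\<lambda>_. 1) \<in> dual_group"
  by (simp add: dual_group_def)

context enumerated
begin

text \<open>Values on generators determine a character on \<open>Lam\<close>; elsewhere the encoding
  fixes the value 1.\<close>

lemma dual_group_eqI:
  fixes \<xi> \<xi>' :: "int^'n^'n \<Rightarrow> complex"
  assumes "\<xi> \<in> dual_group" "\<xi>' \<in> dual_group"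
    and "\<And>m. m < (d - 1) * Suc d \<Longrightarrow> \<xi> (curve_coeff m) = \<xi>' (curve_coeff m)"
  shows "\<xi> = \<xi>'"
proof
  fix A
  interpret \<xi>: lam_hom \<xi> by (rule lam_hom_dual) fact
  interpret \<xi>': lam_hom \<xi>' by (rule lam_hom_dual) fact
  have "Lam \<subseteq> {A \<in> Lam. \<xi> A = \<xi>' A}"
    by (rule curve_coeff_generate)
      (use assms(3) curve_coeff_in_Lam in \<open>auto simp: Lam_0 Lam_diff \<xi>.diff \<xi>'.diff\<close>)
  then show "\<xi> A = \<xi>' A"
    using assms(1,2) by (cases "A \<in> Lam") (auto simp: dual_group_def)
qed

text \<open>Such a character is determined by a finite list of roots of unity. Countability turns
  the absence of atoms into a null set.\<close>

lemma countable_finite_order_characters: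
  "countable {\<xi> :: int^'n^'n \<Rightarrow> complex. nontrivial_finite_order_character \<xi>}"
proof -
  define R where "R = {z :: complex. root_of_unity z}"
  define \<Phi> where "\<Phi> \<xi> = map (\<lambda>m. \<xi> (curve_coeff m)) [0..<(d - 1) * Suc d]" for \<xi> :: "int^'n^'n \<Rightarrow> complex"
  have "R = (\<Union>n\<in>{1..}. {z. z ^ n = 1})" by (auto simp: R_def root_of_unity_def Suc_le_eq)
  moreover have "countable \<dots>"
    by (intro countable_UN) (auto intro!: countable_finite finite_roots_unity)
  ultimately have "countable (lists R)" by simp
  moreover have "\<Phi> ` {\<xi>. nontrivial_finite_order_character \<xi>} \<subseteq> lists R"
  proof (rule image_subsetI)
    fix \<xi> :: "int^'n^'n \<Rightarrow> complex" assume "\<xi> \<in> {\<xi>. nontrivial_finite_order_character \<xi>}"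
    then have "\<xi> g \<in> R" for g
      unfolding R_def root_of_unity_def nontrivial_finite_order_character_def by blast
    then show "\<Phi> \<xi> \<in> lists R" by (simp add: \<Phi>_def in_lists_conv_set image_iff)
  qed
  ultimately have "countable (\<Phi> ` {\<xi>. nontrivial_finite_order_character \<xi>})"
    by (rule countable_subset[rotated])
  moreover have "inj_on \<Phi> {\<xi>. nontrivial_finite_order_character \<xi>}"
  proof (rule inj_onI)
    fix \<xi> \<xi>' assume "\<xi> \<in> {\<xi>. nontrivial_finite_order_character \<xi>}"
      "\<xi>' \<in> {\<xi>. nontrivial_finite_order_character \<xi>}" "\<Phi> \<xi> = \<Phi> \<xi>'"
    moreover from \<open>\<Phi> \<xi> = \<Phi> \<xi>'\<close> have "\<xi> (curve_coeff m) = \<xi>' (curve_coeff m)" if "m < (d - 1) * Suc d" for m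
      using that unfolding \<Phi>_def map_eq_conv set_upt by (metis atLeastLessThan_iff le0)
    ultimately show "\<xi> = \<xi>'"
      unfolding nontrivial_finite_order_character_def by (blast intro: dual_group_eqI)
  qed
  ultimately show ?thesis by (rule countable_image_inj_on)
qed

end

text \<open>The set \<open>S E\<close> of the overview. The trivial character is excluded because
  its mass is estimated separately.\<close>

definition torsion_at :: "int^'n^'n \<Rightarrow> (int^'n^'n \<Rightarrow> complex) set" where
  "torsion_at E = {\<xi> \<in> dual_group. \<xi> \<noteq> (\<lambda>_. 1) \<and> root_of_unity (\<xi> E)}"

text \<open>Serves to pass from the quadratic coefficient, a nonzero multiple of a point of the
  curve, to that point.\<close>

lemma torsion_at_of_int_mult:
  "E \<in> Lam \<Longrightarrow> k \<noteq> 0 \<Longrightarrow> torsion_at (of_int k * E) \<subseteq> torsion_at E"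
  by (auto simp: torsion_at_def dest: lam_hom.root_of_unity_of_int_mult_cancel[OF lam_hom_dual])

text \<open>The inequality suffices to show that sets of positive density are nonempty, and it
  avoids exhibiting a Folner sequence.\<close>

lemma upper_banach_density_empty: "upper_banach_density {} \<le> 0"
  unfolding upper_banach_density_def by (rule SUP_least) (simp add: zero_ereal_def[symmetric] Limsup_const)

subsection \<open>Correlations and the spectral measure\<close>

locale spectral_system =
  fixes X :: "'x::metric_space set" and M :: "'x measure"
    and \<sigma> :: "int^'n^'n \<Rightarrow> 'x \<Rightarrow> 'x" and Bt :: "'x set"
    and \<nu> :: "(int^'n^'n \<Rightarrow> complex) measure"
  assumes mps: "mps X M \<sigma>" and Bt: "Bt \<in> sets M"
    and spectral: "spectral_measure M \<sigma> Bt \<nu>"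
begin

sublocale M: prob_space M
  using mps by (simp add: mps_def)

sublocale \<nu>: finite_measure \<nu>
  using spectral by (simp add: spectral_measure_def)

text \<open>The preimage matches the integral in \<open>spectral_measure\<close>. The forward image
  under \<open>\<sigma> h\<close> in the Furstenberg inequality corresponds to
  \<open>correlation (- h)\<close>.\<close>

definition correlation :: "int^'n^'n \<Rightarrow> real" where
  "correlation h = measure M (Bt \<inter> (\<sigma> h -` Bt \<inter> space M))"

lemma space_nu: "space \<nu> = dual_group"
  using spectral sets_eq_imp_space_eq[of \<nu> "restrict_space borel dual_group"]
  by (simp add: spectral_measure_def space_restrict_space)

lemma measurable_eval [measurable]: "(\<lambda>\<xi>. \<xi> h) \<in> borel_measurable \<nu>"
proof -
  have "(\<lambda>\<xi>. \<xi> h) \<in> borel_measurable (borel :: (int^'n^'n \<Rightarrow> complex) measure)"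
    by (intro borel_measurable_continuous_onI continuous_on_product_coordinates)
  then have "(\<lambda>\<xi>. \<xi> h) \<in> borel_measurable (restrict_space borel (dual_group :: (int^'n^'n \<Rightarrow> complex) set))"
    by (rule measurable_restrict_space1)
  moreover have "sets \<nu> = sets (restrict_space borel dual_group)"
    using spectral by (simp add: spectral_measure_def)
  ultimately show ?thesis by (simp cong: measurable_cong_sets)
qed

lemma singleton_sets: "\<xi> \<in> dual_group \<Longrightarrow> {\<xi>} \<in> sets \<nu>"
  using spectral by (auto simp: spectral_measure_def sets_restrict_space intro!: image_eqI[of _ _ "{\<xi>}"])

lemma trivial_sets [measurable]: "{\<lambda>_. 1} \<in> sets \<nu>"
  by (rule singleton_sets[OF one_in_dual_group])

lemma torsion_at_sets [measurable]: "torsion_at E \<in> sets \<nu>"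
proof -
  have "{\<xi> \<in> space \<nu>. \<exists>n>0. \<xi> E ^ n = 1} - {\<lambda>_. 1} \<in> sets \<nu>" by measurable
  also have "{\<xi> \<in> space \<nu>. \<exists>n>0. \<xi> E ^ n = 1} - {\<lambda>_. 1} = torsion_at E"
    by (auto simp: torsion_at_def root_of_unity_def space_nu)
  finally show ?thesis .
qed

lemma sigma_measurable: "g \<in> Lam \<Longrightarrow> \<sigma> g \<in> measurable M M"
  using mps by (simp add: mps_def)

lemma sigma_vimage_sets: "g \<in> Lam \<Longrightarrow> A \<in> sets M \<Longrightarrow> \<sigma> g -` A \<inter> space M \<in> sets M"
  by (rule measurable_sets[OF sigma_measurable])

lemma measure_sigma_vimage: "g \<in> Lam \<Longrightarrow> A \<in> sets M \<Longrightarrow> measure M (\<sigma> g -` A \<inter> space M) = measure M A"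
  using mps unfolding mps_def measure_def by metis

lemma sigma_space: "g \<in> Lam \<Longrightarrow> x \<in> space M \<Longrightarrow> \<sigma> g x \<in> space M"
  using measurable_space[OF sigma_measurable] .

lemma sigma_add: "g \<in> Lam \<Longrightarrow> h \<in> Lam \<Longrightarrow> x \<in> space M \<Longrightarrow> \<sigma> (g + h) x = \<sigma> g (\<sigma> h x)"
  using mps by (simp add: mps_def)

lemma sigma_zero: "x \<in> space M \<Longrightarrow> \<sigma> 0 x = x"
  using mps by (simp add: mps_def)

lemma integral_eval: "h \<in> Lam \<Longrightarrow> (\<integral>\<xi>. \<xi> h \<partial>\<nu>) = correlation h"
proof -
  assume h: "h \<in> Lam"
  define A where "A = Bt \<inter> (\<sigma> h -` Bt \<inter> space M)"
  have "(\<integral>\<xi>. \<xi> h \<partial>\<nu>) = (\<integral>x. (indicator Bt x :: complex) * cnj (indicator Bt (\<sigma> h x)) \<partial>M)"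
    using spectral h by (simp add: spectral_measure_def)
  also have "\<dots> = (\<integral>x. complex_of_real (indicator A x) \<partial>M)"
    by (intro Bochner_Integration.integral_cong) (auto simp: A_def indicator_def)
  also have "\<dots> = correlation h"
    unfolding integral_complex_of_real by (simp add: A_def correlation_def Int_assoc)
  finally show ?thesis .
qed

lemma sigma_image: "h \<in> Lam \<Longrightarrow> \<sigma> h ` Bt = \<sigma> (- h) -` Bt \<inter> space M"
proof -
  assume h: "h \<in> Lam"
  have "\<sigma> (- h) (\<sigma> h x) = x" "\<sigma> h (\<sigma> (- h) x) = x" if "x \<in> space M" for x
    using sigma_add[of "- h" h x] sigma_add[of h "- h" x] Lam_uminus[OF h] h that by (simp_all add: sigma_zero)
  then show ?thesis
    using sets.sets_into_space[OF Bt] sigma_space[OF h]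
    by (auto simp: subset_iff) (metis image_eqI)
qed

lemma measure_vimage_Int:
  assumes "a \<in> Lam" "b \<in> Lam"
  shows "measure M ((\<sigma> a -` Bt \<inter> space M) \<inter> (\<sigma> b -` Bt \<inter> space M)) = correlation (b - a)"
proof -
  have "(\<sigma> a -` Bt \<inter> space M) \<inter> (\<sigma> b -` Bt \<inter> space M) = \<sigma> a -` (Bt \<inter> (\<sigma> (b - a) -` Bt \<inter> space M)) \<inter> space M"
    using sigma_add[of "b - a" a] sigma_space[OF assms(1)] Lam_diff[OF assms(2,1)] assms by auto
  then show ?thesis
    using measure_sigma_vimage[OF assms(1) sets.Int[OF Bt sigma_vimage_sets[OF Lam_diff[OF assms(2,1)] Bt]]]
    by (simp only: correlation_def)
qed

text \<open>The number \<open>Y x\<close> of indices \<open>i\<close> for which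
  \<open>\<sigma> (f i) x\<close> lies in \<open>Bt\<close> has mean
  \<open>card I * measure M Bt\<close>, and its second moment is the double sum. The variance is
  nonnegative.\<close>

lemma correlation_sum_ge:
  assumes "finite I" "\<And>i. i \<in> I \<Longrightarrow> f i \<in> Lam"
  shows "(real (card I) * measure M Bt)\<^sup>2 \<le> (\<Sum>i\<in>I. \<Sum>j\<in>I. correlation (f j - f i))"
proof -
  define A where "A i = \<sigma> (f i) -` Bt \<inter> space M" for i
  have A: "A i \<in> sets M" if "i \<in> I" for i
    using that assms Bt by (simp add: A_def sigma_vimage_sets)
  define Y where "Y x = (\<Sum>i\<in>I. indicator (A i) x :: real)" for x
  have Y2: "(Y x)\<^sup>2 = (\<Sum>i\<in>I. \<Sum>j\<in>I. indicator (A i \<inter> A j) x)" for x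
    by (simp add: Y_def power2_eq_square sum_product indicator_inter_arith)
  have int: "integrable M Y" "integrable M (\<lambda>x. (Y x)\<^sup>2)"
    unfolding Y2 unfolding Y_def using A by (auto intro!: Bochner_Integration.integrable_sum simp: M.emeasure_eq_measure)
  have "(\<integral>x. Y x \<partial>M) = (\<Sum>i\<in>I. measure M (A i))"
    unfolding Y_def using A
    by (subst Bochner_Integration.integral_sum) (auto simp: M.emeasure_eq_measure A_def intro!: sum.cong)
  also have "\<dots> = real (card I) * measure M Bt"
    using assms Bt by (simp add: A_def measure_sigma_vimage)
  finally have "(\<integral>x. Y x \<partial>M) = real (card I) * measure M Bt" .
  moreover have "(\<integral>x. (Y x)\<^sup>2 \<partial>M) = (\<Sum>i\<in>I. \<Sum>j\<in>I. measure M (A i \<inter> A j))"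
    unfolding Y2 using A sets.sets_into_space
    by (subst Bochner_Integration.integral_sum)
      (auto intro!: sum.cong Bochner_Integration.integrable_sum simp: M.emeasure_eq_measure Bochner_Integration.integral_sum Int_absorb2 A_def)
  moreover have "(\<integral>x. Y x \<partial>M)\<^sup>2 \<le> (\<integral>x. (Y x)\<^sup>2 \<partial>M)"
    using M.variance_eq[OF int] M.variance_positive[of Y] by simp
  ultimately show ?thesis
    using assms by (simp add: A_def measure_vimage_Int)
qed

lemma integrable_eval: "integrable \<nu> (\<lambda>\<xi>. \<xi> h)"
  by (rule \<nu>.integrable_const_bound[of _ 1]) (auto simp: space_nu cmod_dual)

text \<open>The squared averages of the powers of \<open>\<xi> E\<close> integrate to averaged
  correlations, which are at least the square of the measure of \<open>Bt\<close>. They converge to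
  the indicator of \<open>\<xi> E = 1\<close>, a set consisting of the trivial character and part of
  \<open>torsion_at E\<close>.\<close>

lemma measure_Bt_le:
  assumes E: "E \<in> Lam"
  shows "(measure M Bt)\<^sup>2 \<le> measure \<nu> {\<lambda>_. 1} + measure \<nu> (torsion_at E)"
proof -
  define f where "f N \<xi> = (cmod ((\<Sum>n<N. \<xi> E ^ n) / of_nat N))\<^sup>2" for N and \<xi> :: "int^'n^'n \<Rightarrow> complex"
  define T where "T = {\<xi> \<in> space \<nu>. \<xi> E = 1}"
  have T [measurable]: "T \<in> sets \<nu>" unfolding T_def by measurable
  have meas [measurable]: "f N \<in> borel_measurable \<nu>" for N unfolding f_def by measurable
  have unit: "cmod (\<xi> E) = 1" if "\<xi> \<in> space \<nu>" for \<xi>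
    using that by (simp add: space_nu cmod_dual)
  have f_eq: "complex_of_real (f N \<xi>) = (\<Sum>n<N. \<Sum>m<N. \<xi> (of_nat m * E - of_nat n * E)) / of_nat (N\<^sup>2)"
    if "\<xi> \<in> space \<nu>" for N \<xi>
  proof -
    interpret lam_hom \<xi> using that by (intro lam_hom_dual) (simp add: space_nu)
    have "\<xi> (of_nat m * E - of_nat n * E) = \<xi> E ^ m * cnj (\<xi> E ^ n)" for m n
    proof -
      have "\<xi> E ^ n * cnj (\<xi> E ^ n) = 1"
        using unit[OF that] by (simp add: complex_norm_square[symmetric] flip: power_mult_distrib)
      then have "inverse (\<xi> E ^ n) = cnj (\<xi> E ^ n)" by (metis inverse_unique)
      then show ?thesis
        using E by (simp add: diff Lam_of_nat_mult of_nat_mult divide_inverse)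
    qed
    then have "(\<Sum>n<N. \<Sum>m<N. \<xi> (of_nat m * E - of_nat n * E)) = (\<Sum>n<N. \<xi> E ^ n) * cnj (\<Sum>n<N. \<xi> E ^ n)"
      by (subst sum.swap) (simp add: sum_product mult.commute)
    moreover have "complex_of_real (f N \<xi>) = ((\<Sum>n<N. \<xi> E ^ n) / of_nat N) * cnj ((\<Sum>n<N. \<xi> E ^ n) / of_nat N)"
      unfolding f_def by (rule complex_norm_square)
    ultimately show ?thesis by (simp add: power2_eq_square)
  qed
  have lower: "(measure M Bt)\<^sup>2 \<le> (\<integral>\<xi>. f N \<xi> \<partial>\<nu>)" if "N > 0" for N
  proof -
    have "complex_of_real (\<integral>\<xi>. f N \<xi> \<partial>\<nu>) = (\<integral>\<xi>. complex_of_real (f N \<xi>) \<partial>\<nu>)" by simp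
    also have "\<dots> = (\<integral>\<xi>. (\<Sum>n<N. \<Sum>m<N. \<xi> (of_nat m * E - of_nat n * E)) / of_nat (N\<^sup>2) \<partial>\<nu>)"
      by (intro Bochner_Integration.integral_cong refl f_eq)
    also have "\<dots> = (\<Sum>n<N. \<Sum>m<N. complex_of_real (correlation (of_nat m * E - of_nat n * E))) / of_nat (N\<^sup>2)"
      using E by (simp add: Bochner_Integration.integral_sum integrable_eval Bochner_Integration.integrable_sum integral_eval Lam_diff Lam_of_nat_mult)
    also have "\<dots> = complex_of_real ((\<Sum>n<N. \<Sum>m<N. correlation (of_nat m * E - of_nat n * E)) / real (N\<^sup>2))"
      by simp
    finally have "(\<integral>\<xi>. f N \<xi> \<partial>\<nu>) = (\<Sum>n<N. \<Sum>m<N. correlation (of_nat m * E - of_nat n * E)) / real (N\<^sup>2)"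
      unfolding of_real_eq_iff .
    moreover have "(real N * measure M Bt)\<^sup>2 \<le> (\<Sum>n<N. \<Sum>m<N. correlation (of_nat m * E - of_nat n * E))"
      using correlation_sum_ge[of "{..<N}" "\<lambda>n. of_nat n * E"] E by (simp add: Lam_of_nat_mult)
    ultimately show ?thesis
      using that by (simp add: pos_le_divide_eq power_mult_distrib mult.commute)
  qed
  have "(\<lambda>N. \<integral>\<xi>. f N \<xi> \<partial>\<nu>) \<longlonglongrightarrow> (\<integral>\<xi>. indicator T \<xi> \<partial>\<nu>)"
  proof (rule integral_dominated_convergence[where w = "\<lambda>_. 1"])
    show "AE \<xi> in \<nu>. (\<lambda>N. f N \<xi>) \<longlonglongrightarrow> indicator T \<xi>"
    proof (rule AE_I2)
      fix \<xi> assume \<xi>: "\<xi> \<in> space \<nu>"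
      show "(\<lambda>N. f N \<xi>) \<longlonglongrightarrow> indicator T \<xi>"
      proof (cases "\<xi> E = 1")
        case True
        have "\<forall>\<^sub>F N in sequentially. f N \<xi> = indicator T \<xi>"
          using eventually_gt_at_top[of 0] by eventually_elim (use True \<xi> in \<open>simp add: f_def T_def\<close>)
        then show ?thesis by (rule tendsto_eventually)
      next
        case False
        then have "(\<lambda>N. (\<Sum>n<N. \<xi> E ^ n) / of_nat N) \<longlonglongrightarrow> 0"
          using unit[OF \<xi>] by (intro geometric_averages_tendsto_0)
        then have "(\<lambda>N. f N \<xi>) \<longlonglongrightarrow> (cmod 0)\<^sup>2" unfolding f_def by (intro tendsto_intros)
        then show ?thesis using False by (simp add: T_def)
      qed
    qed
    show "AE \<xi> in \<nu>. norm (f N \<xi>) \<le> 1" for N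
    proof (rule AE_I2)
      fix \<xi> assume \<xi>: "\<xi> \<in> space \<nu>"
      have "cmod (\<Sum>n<N. \<xi> E ^ n) \<le> (\<Sum>n<N. 1)"
        using unit[OF \<xi>] by (intro sum_norm_le) (simp add: norm_power)
      then have "cmod ((\<Sum>n<N. \<xi> E ^ n) / of_nat N) \<le> 1"
        by (cases "N = 0") (simp_all add: norm_divide divide_le_eq_1)
      then show "norm (f N \<xi>) \<le> 1" by (simp add: f_def power_le_one)
    qed
  qed auto
  then have "(\<lambda>N. \<integral>\<xi>. f N \<xi> \<partial>\<nu>) \<longlonglongrightarrow> measure \<nu> T" by (simp add: T_def Int_absorb1)
  then have "(measure M Bt)\<^sup>2 \<le> measure \<nu> T"
    by (rule tendsto_lowerbound) (use lower in \<open>auto intro: eventually_mono[OF eventually_gt_at_top[of 0]]\<close>)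
  also have "\<dots> \<le> measure \<nu> ({\<lambda>_. 1} \<union> torsion_at E)"
  proof (rule \<nu>.finite_measure_mono)
    show "T \<subseteq> {\<lambda>_. 1} \<union> torsion_at E" by (auto simp: T_def torsion_at_def space_nu)
  qed (rule sets.Un[OF trivial_sets torsion_at_sets])
  also have "\<dots> \<le> measure \<nu> {\<lambda>_. 1} + measure \<nu> (torsion_at E)"
    by (intro measure_Un_le) auto
  finally show ?thesis .
qed

text \<open>Since the correlations vanish, the averaged phases have integral 0. Outside
  \<open>torsion_at D\<close> they converge to the indicator of the trivial character by Weyl's
  theorem; on \<open>torsion_at D\<close> they have modulus at most 1.\<close>

lemma measure_trivial_le:
  assumes "C \<in> Lam" "P \<in> Lam" "D \<in> Lam"
    and zero: "\<And>n. correlation (C + of_nat n * P - of_nat (n\<^sup>2) * D) = 0"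
  shows "measure \<nu> {\<lambda>_. 1} \<le> measure \<nu> (torsion_at D)"
proof -
  define h where "h N \<xi> = (\<Sum>n<N. \<xi> (C + of_nat n * P - of_nat (n\<^sup>2) * D)) / of_nat N"
    for N and \<xi> :: "int^'n^'n \<Rightarrow> complex"
  have meas [measurable]: "h N \<in> borel_measurable \<nu>" for N unfolding h_def by measurable
  have Lam: "C + of_nat n * P - of_nat (n\<^sup>2) * D \<in> Lam" for n
    using assms(1-3) by (intro Lam_diff Lam_add Lam_of_nat_mult)
  have bound: "cmod (h N \<xi>) \<le> 1" if "\<xi> \<in> space \<nu>" for N \<xi>
  proof -
    have "cmod (\<Sum>n<N. \<xi> (C + of_nat n * P - of_nat (n\<^sup>2) * D)) \<le> (\<Sum>n<N. 1)"
      using that by (intro sum_norm_le) (simp add: space_nu cmod_dual)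
    then show ?thesis by (cases "N = 0") (simp_all add: h_def norm_divide divide_le_eq_1)
  qed
  have int: "integrable \<nu> (h N)" for N
    by (rule \<nu>.integrable_const_bound[of _ 1]) (auto simp: bound)
  have int_h: "(\<integral>\<xi>. h N \<xi> \<partial>\<nu>) = 0" for N
    unfolding h_def by (simp add: Bochner_Integration.integral_sum integrable_eval integral_eval[OF Lam] zero del: of_nat_power)
  \<comment> \<open>The limit of the averages is not controlled on \<open>torsion_at D\<close>, so
    this set is cut off before dominated convergence.\<close>
  define G where "G = space \<nu> - torsion_at D"
  have G [measurable]: "G \<in> sets \<nu>" by (simp add: G_def)
  have "(\<lambda>N. \<integral>\<xi>. indicator G \<xi> *\<^sub>R h N \<xi> \<partial>\<nu>) \<longlonglongrightarrow> (\<integral>\<xi>. complex_of_real (indicator {\<lambda>_. 1} \<xi>) \<partial>\<nu>)"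
  proof (rule integral_dominated_convergence[where w = "\<lambda>_. 1"])
    show "AE \<xi> in \<nu>. (\<lambda>N. indicator G \<xi> *\<^sub>R h N \<xi>) \<longlonglongrightarrow> complex_of_real (indicator {\<lambda>_. 1} \<xi>)"
    proof (rule AE_I2)
      fix \<xi> assume \<xi>: "\<xi> \<in> space \<nu>"
      consider "\<xi> = (\<lambda>_. 1)" | "\<xi> \<in> torsion_at D" | "\<xi> \<noteq> (\<lambda>_. 1)" "\<not> root_of_unity (\<xi> D)"
        using \<xi> by (auto simp: torsion_at_def space_nu)
      then show "(\<lambda>N. indicator G \<xi> *\<^sub>R h N \<xi>) \<longlonglongrightarrow> complex_of_real (indicator {\<lambda>_. 1} \<xi>)"
      proof cases
        case 1
        have "\<forall>\<^sub>F N in sequentially. indicator G \<xi> *\<^sub>R h N \<xi> = complex_of_real (indicator {\<lambda>_. 1} \<xi>)"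
          using eventually_gt_at_top[of 0]
          by eventually_elim (use 1 \<xi> in \<open>simp add: h_def G_def torsion_at_def\<close>)
        then show ?thesis by (rule tendsto_eventually)
      next
        case 2
        then have "\<xi> \<notin> G" "\<xi> \<noteq> (\<lambda>_. 1)" by (auto simp: G_def torsion_at_def)
        then show ?thesis by simp
      next
        case 3
        interpret lam_hom \<xi> using \<xi> by (intro lam_hom_dual) (simp add: space_nu)
        have "\<xi> (C + of_nat n * P - of_nat (n\<^sup>2) * D) = \<xi> C * \<xi> P ^ n * inverse (\<xi> D) ^ (n\<^sup>2)" for n
          using assms(1-3)
          by (simp add: add diff of_nat_mult Lam_add Lam_of_nat_mult divide_inverse power_inverse del: of_nat_power)
        then have "h N \<xi> = (\<Sum>n<N. \<xi> C * \<xi> P ^ n * inverse (\<xi> D) ^ (n\<^sup>2)) / of_nat N" for N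
          by (simp add: h_def)
        moreover have "(\<lambda>N. (\<Sum>n<N. \<xi> C * \<xi> P ^ n * inverse (\<xi> D) ^ (n\<^sup>2)) / of_nat N) \<longlonglongrightarrow> 0"
          using 3 \<xi> by (intro Weyl_quadratic) (simp_all add: space_nu cmod_dual norm_inverse)
        ultimately have "(\<lambda>N. h N \<xi>) \<longlonglongrightarrow> 0" by simp
        then have "(\<lambda>N. indicator G \<xi> *\<^sub>R h N \<xi>) \<longlonglongrightarrow> indicator G \<xi> *\<^sub>R 0" by (intro tendsto_intros)
        then show ?thesis using 3 by simp
      qed
    qed
    show "AE \<xi> in \<nu>. norm (indicator G \<xi> *\<^sub>R h N \<xi>) \<le> 1" for N
      by (rule AE_I2) (auto simp: bound indicator_def)
  qed auto
  moreover have "(\<integral>\<xi>. complex_of_real (indicator {\<lambda>_. 1} \<xi>) \<partial>\<nu>) = complex_of_real (measure \<nu> {\<lambda>_. 1})"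
    unfolding integral_complex_of_real by (simp add: one_in_dual_group space_nu)
  ultimately have lim: "(\<lambda>N. \<integral>\<xi>. indicator G \<xi> *\<^sub>R h N \<xi> \<partial>\<nu>) \<longlonglongrightarrow> complex_of_real (measure \<nu> {\<lambda>_. 1})"
    by simp
  have "cmod (\<integral>\<xi>. indicator G \<xi> *\<^sub>R h N \<xi> \<partial>\<nu>) \<le> measure \<nu> (torsion_at D)" for N
  proof -
    \<comment> \<open>The total integral is 0, so the integrals over \<open>G\<close> and over
      \<open>torsion_at D\<close> are opposite.\<close>
    have "(\<integral>\<xi>. indicator G \<xi> *\<^sub>R h N \<xi> \<partial>\<nu>) + (\<integral>\<xi>. indicator (torsion_at D) \<xi> *\<^sub>R h N \<xi> \<partial>\<nu>)
        = (\<integral>\<xi>. indicator G \<xi> *\<^sub>R h N \<xi> + indicator (torsion_at D) \<xi> *\<^sub>R h N \<xi> \<partial>\<nu>)"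
      by (intro Bochner_Integration.integral_add[symmetric] integrable_mult_indicator int) auto
    also have "\<dots> = (\<integral>\<xi>. h N \<xi> \<partial>\<nu>)"
      by (intro Bochner_Integration.integral_cong) (auto simp: G_def indicator_def)
    finally have "(\<integral>\<xi>. indicator G \<xi> *\<^sub>R h N \<xi> \<partial>\<nu>) = - (\<integral>\<xi>. indicator (torsion_at D) \<xi> *\<^sub>R h N \<xi> \<partial>\<nu>)"
      unfolding int_h by (simp add: add_eq_0_iff2)
    then have "cmod (\<integral>\<xi>. indicator G \<xi> *\<^sub>R h N \<xi> \<partial>\<nu>) = cmod (\<integral>\<xi>. indicator (torsion_at D) \<xi> *\<^sub>R h N \<xi> \<partial>\<nu>)" by simp
    also have "\<dots> \<le> (\<integral>\<xi>. indicator (torsion_at D) \<xi> \<partial>\<nu>)"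
    proof (rule order_trans[OF integral_norm_bound integral_mono])
      show "integrable \<nu> (\<lambda>\<xi>. norm (indicator (torsion_at D) \<xi> *\<^sub>R h N \<xi>))"
        by (intro integrable_norm integrable_mult_indicator int torsion_at_sets)
      show "integrable \<nu> (indicator (torsion_at D) :: _ \<Rightarrow> real)"
        by (simp add: \<nu>.emeasure_eq_measure)
    qed (auto simp: indicator_def bound)
    also have "\<dots> = measure \<nu> (torsion_at D)"
      using sets.sets_into_space[OF torsion_at_sets, of D] by (simp add: Int_absorb2)
    finally show ?thesis .
  qed
  then have "cmod (complex_of_real (measure \<nu> {\<lambda>_. 1})) \<le> measure \<nu> (torsion_at D)"
    by (intro tendsto_upperbound[OF tendsto_norm[OF lim]]) auto
  then show ?thesis by simp
qed

text \<open>A character outside the null set of nontrivial characters of finite order lies in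
  \<open>torsion_at (curve t)\<close> for only finitely many \<open>t\<close>, so dominated
  convergence applies.\<close>

lemma measure_torsion_at_curve_tendsto_0:
  assumes "enumerated e d"
    and null: "\<And>\<xi>. nontrivial_finite_order_character \<xi> \<Longrightarrow> emeasure \<nu> {\<xi>} = 0"
  shows "(\<lambda>t. measure \<nu> (torsion_at (enumerated.curve e d t))) \<longlonglongrightarrow> 0"
proof -
  interpret enumerated e d by fact
  define Fin where "Fin = {\<xi> :: int^'n^'n \<Rightarrow> complex. nontrivial_finite_order_character \<xi>}"
  have "(\<Union>\<xi>\<in>Fin. {\<xi>}) \<in> null_sets \<nu>"
    unfolding Fin_def
    by (intro null_sets_UN' countable_finite_order_characters)
      (auto simp: null_sets_def null singleton_sets nontrivial_finite_order_character_def)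
  then have "Fin \<in> null_sets \<nu>" by simp
  then have AE: "AE \<xi> in \<nu>. \<xi> \<notin> Fin" by (rule AE_not_in)
  have "(\<lambda>t. \<integral>\<xi>. indicator (torsion_at (curve t)) \<xi> \<partial>\<nu>) \<longlonglongrightarrow> (\<integral>\<xi>. (0 :: real) \<partial>\<nu>)"
  proof (rule integral_dominated_convergence[where w = "\<lambda>_. 1"])
    show "AE \<xi> in \<nu>. (\<lambda>t. indicator (torsion_at (curve t)) \<xi>) \<longlonglongrightarrow> (0 :: real)"
      using AE AE_space
    proof eventually_elim
      case (elim \<xi>)
      have "finite {t. \<xi> \<in> torsion_at (curve t)}"
      proof (rule ccontr)
        assume inf: "infinite {t. \<xi> \<in> torsion_at (curve t)}"
        then obtain t where "\<xi> \<in> torsion_at (curve t)" using infinite_imp_nonempty by blast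
        then have \<xi>: "\<xi> \<in> dual_group" "\<xi> \<noteq> (\<lambda>_. 1)" by (auto simp: torsion_at_def)
        interpret lam_hom \<xi> by (rule lam_hom_dual) fact
        interpret enumerated_hom e d \<xi> ..
        have "infinite {t. root_of_unity (\<xi> (curve t))}"
          using inf by (rule infinite_super[rotated]) (auto simp: torsion_at_def)
        then obtain n where "n > 0" "\<forall>A\<in>Lam. \<xi> A ^ n = 1"
          using finite_order_if_infinitely_often_torsion by blast
        then have "\<xi> A ^ n = 1" for A
          using \<xi> by (cases "A \<in> Lam") (auto simp: dual_group_def)
        then have "nontrivial_finite_order_character \<xi>"
          unfolding nontrivial_finite_order_character_def using \<xi> \<open>n > 0\<close> by blast
        then show False using elim(1) by (simp add: Fin_def)
      qed
      then have "\<forall>\<^sub>F t in sequentially. \<xi> \<notin> torsion_at (curve t)"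
        by (simp add: eventually_cofinite flip: cofinite_eq_sequentially)
      then have "\<forall>\<^sub>F t in sequentially. indicator (torsion_at (curve t)) \<xi> = (0 :: real)"
        by eventually_elim simp
      then show ?case by (rule tendsto_eventually)
    qed
  qed (auto simp: indicator_def)
  moreover have "(\<integral>\<xi>. indicator (torsion_at (curve t)) \<xi> \<partial>\<nu>) = measure \<nu> (torsion_at (curve t))" for t
    using sets.sets_into_space[OF torsion_at_sets, of "curve t"] by (simp add: Int_absorb2)
  ultimately show ?thesis by simp
qed

end

subsection \<open>Conjugates in difference sets\<close>

theorem theorem1p3:
  fixes B :: "(int^'n^'n) set"
    and X :: "'x::metric_space set" and M :: "'x measure"
    and \<sigma> :: "int^'n^'n \<Rightarrow> 'x \<Rightarrow> 'x" and Bt :: "'x set"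
    and \<nu> :: "(int^'n^'n \<Rightarrow> complex) measure"
  assumes "CARD('n) \<ge> 2"
    and "B \<subseteq> Lam"
    and "upper_banach_density B > 0"
    and "ergodic_furstenberg_system B X M \<sigma> Bt"
    and "spectral_measure M \<sigma> Bt \<nu>"
    and "\<forall>\<xi>. nontrivial_finite_order_character \<xi> \<longrightarrow> emeasure \<nu> {\<xi>} = 0"
  shows "\<forall>C\<in>Lam. \<exists>A\<in>{a - b | a b. a \<in> B \<and> b \<in> B}. \<exists>g ginv :: int^'n^'n.
           det g = 1 \<and> g ** ginv = mat 1 \<and> ginv ** g = mat 1 \<and> C = ginv ** A ** g"
proof
  fix C :: "int^'n^'n" assume C: "C \<in> Lam"
  interpret spectral_system X M \<sigma> Bt \<nu>
    using assms(4,5) by unfold_locales (auto simp: ergodic_furstenberg_system_def ergodic_mps_def)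
  obtain e :: "'n \<Rightarrow> nat" where "bij_betw e UNIV {0..<CARD('n)}"
    using ex_bij_betw_finite_nat[OF finite_class.finite_UNIV] by blast
  then interpret enumerated e "CARD('n)"
    using assms(1) by unfold_locales (auto simp: atLeast0LessThan)
  \<comment> \<open>A nonzero correlation makes the density of the intersection of \<open>B\<close>
    with its translate by \<open>h\<close> positive, so the intersection is nonempty.\<close>
  have difference: "h \<in> {a - b | a b. a \<in> B \<and> b \<in> B}" if h: "h \<in> Lam" "correlation (- h) \<noteq> 0" for h
  proof -
    have "0 < correlation (- h)" using h(2) by (simp add: correlation_def zero_less_measure_iff)
    also have "correlation (- h) = measure M (Bt \<inter> \<sigma> h ` Bt)"
      by (simp add: correlation_def sigma_image[OF h(1)])
    finally have "0 < ereal (measure M (Bt \<inter> \<sigma> h ` Bt))" by simp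
    also have "\<dots> \<le> upper_banach_density (B \<inter> (\<lambda>b. b + h) ` B)"
      using assms(4) h(1) by (simp add: ergodic_furstenberg_system_def)
    finally have "B \<inter> (\<lambda>b. b + h) ` B \<noteq> {}"
      using upper_banach_density_empty by (metis leD)
    then obtain b where "b + h \<in> B" "b \<in> B" by auto
    moreover have "h = (b + h) - b" by simp
    ultimately show ?thesis by blast
  qed
  show "\<exists>A\<in>{a - b | a b. a \<in> B \<and> b \<in> B}. \<exists>g ginv :: int^'n^'n.
           det g = 1 \<and> g ** ginv = mat 1 \<and> ginv ** g = mat 1 \<and> C = ginv ** A ** g"
  proof (cases "C = 0")
    \<comment> \<open>The zero matrix is separate because the trace functional along the curve is
      then identically zero.\<close>
    case True
    have "B \<noteq> {}" using assms(3) upper_banach_density_empty by (metis leD)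
    then obtain b where "b \<in> B" by blast
    moreover have "0 = b - b" by simp
    ultimately have "0 \<in> {a - b | a b. a \<in> B \<and> b \<in> B}" by blast
    moreover have "det (mat 1 :: int^'n^'n) = 1 \<and> mat 1 ** mat 1 = (mat 1 :: int^'n^'n)
        \<and> mat 1 ** mat 1 = (mat 1 :: int^'n^'n) \<and> C = mat 1 ** 0 ** mat 1"
      using True by simp
    ultimately show ?thesis by blast
  next
    case False
    show ?thesis
    proof (rule ccontr)
      assume no: "\<not> ?thesis"
      have le: "measure \<nu> {\<lambda>_. 1} \<le> measure \<nu> (torsion_at (curve t))" if t: "trace (C ** curve t) \<noteq> 0" for t
      proof -
        \<comment> \<open>The doubling guarantees determinant 1 through
          \<open>det_unipotent_double\<close>.\<close>
        define F where "F = curve t + curve t"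
        have F: "F ** F = 0" unfolding F_def matrix_distribs curve_square by simp
        define P where "P = F ** C - C ** F"
        define D where "D = F ** C ** F"
        have D_eq: "D = of_int (4 * trace (C ** curve t)) * curve t"
          unfolding D_def F_def matrix_distribs curve_sandwich by (simp add: distrib_right)
        have Lam: "P \<in> Lam" "D \<in> Lam"
          by (simp_all add: P_def D_def Lam_commutator Lam_square_zero_sandwich[OF F])
        \<comment> \<open>All signs are reversed because membership of \<open>h\<close> in the
          difference set is detected by \<open>correlation (- h)\<close>.\<close>
        have "measure \<nu> {\<lambda>_. 1} \<le> measure \<nu> (torsion_at (- D))"
        proof (rule measure_trivial_le)
          show "- C \<in> Lam" "- P \<in> Lam" "- D \<in> Lam" using C Lam by (simp_all add: Lam_uminus)
          fix n :: nat
          define g where "g = mat 1 + of_nat n * F"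
          define g' where "g' = mat 1 - of_nat n * F"
          have inv: "g ** g' = mat 1" "g' ** g = mat 1"
            by (simp_all add: g_def g'_def unipotent_inverse[OF F])
          have det: "det g = 1"
            unfolding g_def F_def by (rule det_unipotent_double[OF curve_square])
          have conj: "g ** C ** g' = C + of_nat n * P - of_nat (n\<^sup>2) * D"
            unfolding g_def g'_def P_def D_def by (rule unipotent_conj[OF F])
          have "g' ** (g ** C ** g') ** g = (g' ** g) ** C ** (g' ** g)"
            by (simp add: matrix_mul_assoc)
          then have "C = g' ** (g ** C ** g') ** g" by (simp add: inv)
          with no det inv have "g ** C ** g' \<notin> {a - b | a b. a \<in> B \<and> b \<in> B}" by blast
          moreover have "g ** C ** g' \<in> Lam"
            unfolding conj using C Lam by (intro Lam_diff Lam_add Lam_of_nat_mult)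
          ultimately have "correlation (- (g ** C ** g')) = 0" using difference by blast
          moreover have "- (g ** C ** g') = - C + of_nat n * - P - of_nat (n\<^sup>2) * - D"
            unfolding conj by simp
          ultimately show "correlation (- C + of_nat n * - P - of_nat (n\<^sup>2) * - D) = 0" by simp
        qed
        also have "- D = of_int (- 4 * trace (C ** curve t)) * curve t" by (simp add: D_eq)
        also have "measure \<nu> (torsion_at (of_int (- 4 * trace (C ** curve t)) * curve t)) \<le> measure \<nu> (torsion_at (curve t))"
          using t by (intro \<nu>.finite_measure_mono torsion_at_of_int_mult curve_in_Lam) auto
        finally show ?thesis .
      qed
      have lim: "(\<lambda>t. measure \<nu> (torsion_at (curve t))) \<longlonglongrightarrow> 0"
        using measure_torsion_at_curve_tendsto_0 enumerated_axioms assms(6) by blast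
      have "\<forall>\<^sub>F t in sequentially. trace (C ** curve t) \<noteq> 0"
        using finite_trace_curve_zero[OF C False]
        by (simp add: eventually_cofinite flip: cofinite_eq_sequentially)
      then have "\<forall>\<^sub>F t in sequentially. measure \<nu> {\<lambda>_. 1} \<le> measure \<nu> (torsion_at (curve t))"
        by eventually_elim (rule le)
      \<comment> \<open>With no mass at the trivial character, \<open>measure_Bt_le\<close> bounds
        the square of the measure of \<open>Bt\<close> by a sequence tending to 0, contradicting
        positive density.\<close>
      then have "measure \<nu> {\<lambda>_. 1} \<le> 0"
        by (intro tendsto_lowerbound[OF lim]) auto
      then have "(measure M Bt)\<^sup>2 \<le> measure \<nu> (torsion_at (curve t))" for t
        using measure_Bt_le[OF curve_in_Lam[of t]] by linarith
      then have "(measure M Bt)\<^sup>2 \<le> 0"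
        by (intro tendsto_lowerbound[OF lim]) auto
      moreover have "measure M Bt > 0"
        using assms(3,4) unfolding ergodic_furstenberg_system_def by (metis ereal_less(2))
      ultimately show False by simp
    qed
  qed
qed

end
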